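(* Consider the two-phase RSPG (2-RSPG) algorithm described in the context (with parameter $\tilde D>0$), under Assumptions A1 and A2, with $\|\cdot\|$ the Euclidean norm. Let $D_\Psi:=[(\Psi(x_1)-\Psi^* )/L]^{1/2}$, let $g_X(x):=P_X(x,\nabla f(x),\alpha/(2L))$ for $x\in X$, and let $$\mathcal{B}_{\bar N}:=\frac{16LD_\Psi^2}{\bar N}+\frac{4\sqrt6\,\sigma}{\sqrt{\bar N}}\left(\frac{D_\Psi^2}{\tilde D}+\tilde D\max\left\{1,\frac{\sqrt6\,\sigma}{4L\tilde D\sqrt{\bar N}}\right\}\right).$$ Then the output $\bar x^*$ satisfies: (a) For all $\lambda>0$, $$\mathrm{Prob}\left\{\|g_X(\bar x^* )\|^2\ge\frac{8L\mathcal{B}_{\bar N}}{\alpha^2}+\frac{12(1+\lambda)^2\sigma^2}{T\alpha^2}\right\}\le S\exp\left(-\frac{\lambda^2}{3}\right)+2^{-S}.$$ (b) Let $\epsilon>0$ and $\Lambda\in(0,1)$. If $S$ and $\bar N$ are set to $$S(\Lambda):=\lceil\log_2(2/\Lambda)\rceil,$$ $$\bar N(\epsilon):=\left\lceil\max\left\{\frac{512L^2D_\Psi^2}{\alpha^2\epsilon},\left[\left(\tilde D+\frac{D_\Psi^2}{\tilde D}\right)\frac{128\sqrt6\,L\sigma}{\alpha^2\epsilon}\right]^2,\frac{3\sigma^2}{8L^2\tilde D^2}\right\}\right\rceil,$$ and the sample size $T$ is set to $$T'(\epsilon,\Lambda):=\left\lceil\frac{24\sigma^2}{\alpha^2\epsilon}\left[1+\left(3\log_2\frac{2S(\Lambda)}{\Lambda}\right)^{1/2}\right]^2\right\rceil,$$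 then the 2-RSPG algorithm computes an $(\epsilon,\Lambda)$-solution, i.e. $\mathrm{Prob}\{\|g_X(\bar x^* )\|^2\le\epsilon\}\ge1-\Lambda$, after taking at most $S(\Lambda)[\bar N(\epsilon)+T'(\epsilon,\Lambda)]$ calls to the stochastic first-order oracle.
   Context: Setting. $\langle\cdot,\cdot\rangle$ and $\|\cdot\|$ are the standard Euclidean inner product and norm on $\mathbb{R}^n$. $X\subseteq\mathbb{R}^n$ is a nonempty closed convex set; $f:X\to\mathbb{R}$ is continuously differentiable (possibly nonconvex) with $\|\nabla f(y)-\nabla f(x)\|\le L\|y-x\|$ for all $x,y\in X$, where $L>0$; $h:X\to\mathbb{R}$ is convex (possibly nonsmooth); $\Psi:=f+h$ and $\Psi^*:=\inf_{x\in X}\Psi(x)$ is finite. Prox-function. $\omega:X\to\mathbb{R}$ is continuously differentiable and satisfies $\langle x-z,\nabla\omega(x)-\nabla\omega(z)\rangle\ge\alpha\|x-z\|^2$ for all $x,z\in X$, with $\alpha>0$. $V(x,z):=\omega(x)-[\omega(z)+\langle\nabla\omega(z),x-z\rangle]$. For $x\in X$, $g\in\mathbb{R}^n$, $\gamma>0$ let $x^+:=\arg\min_{u\in X}\{\langle g,u\rangle+\frac1\gamma V(u,x)+h(u)\}$ (always assumed solvable), and $P_X(x,g,\gamma):=\frac1\gamma(x-x^+)$. RSPG algorithm. Input: $x_1\in X$, iteration limit $N$, stepsizes $\gamma_k>0$, positive integer batch sizes $m_k$, probability mass function $P_R$ on $\{1,\dots,N\}$. Draw $R\sim P_R$, independently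 of all samples. For $k=1,\dots,R-1$: call the stochastic first-order oracle $m_k$ times to obtain $G(x_k,\xi_{k,i})$, $i=1,\dots,m_k$ ($G$ a Borel function), set $G_k=\frac1{m_k}\sum_{i=1}^{m_k}G(x_k,\xi_{k,i})$ and $x_{k+1}=\arg\min_{u\in X}\{\langle G_k,u\rangle+\frac1{\gamma_k}V(u,x_k)+h(u)\}$. Output $x_R$. 2-RSPG algorithm. Input: $x_1\in X$, number of runs $S\ge1$, number $\bar N\ge1$ of oracle calls allowed in each run, and post-optimization sample size $T\ge1$. Optimization phase: perform $S$ independent runs of the RSPG algorithm, each from $x_1$, with $m_k=m=\lceil\min\{\max\{1,\frac{\sigma\sqrt{6\bar N}}{4L\tilde D}\},\bar N\}\rceil$ for a fixed parameter $\tilde D>0$, $N=\lfloor\bar N/m\rfloor$, $\gamma_k=\alpha/(2L)$ and $P_R(k)=(\alpha\gamma_k-L\gamma_k^2)/\sum_{j=1}^N(\alpha\gamma_j-L\gamma_j^2)$; let $\bar x_1,\dots,\bar x_S$ be the outputs. Post-optimization phase: for each $s$ let $\bar G_T(\bar x_s)=\frac1T\sum_{k=1}^TG(\bar x_s,\xi_k)$ (formed from $T$ new oracle calls at $\bar x_s$) and $\bar g_X(\bar x_s):=P_X(\bar x_s,\bar G_T(\bar x_s),\alpha/(2L))$; output $\bar x^*\in\{\bar x_1,\dots,\bar x_S\}$ with $\|\bar g_X(\bar x^* )\|=\min_{s=1,\dots,S}\|\bar g_X(\bar x_s)\|$. Assumptions (with constant $\sigma>0$). Whenever the oracle is called at a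 point $x\in X$, it returns $G(x,\xi)$ such that, conditionally on $x$ and all previously drawn samples (in the post-optimization phase: conditionally on the candidates and the earlier post-optimization samples at that candidate): A1: $\mathbb{E}[G(x,\xi)]=\nabla f(x)$ and $\mathbb{E}[\|G(x,\xi)-\nabla f(x)\|^2]\le\sigma^2$; A2: $\mathbb{E}[\exp\{\|G(x,\xi)-\nabla f(x)\|^2/\sigma^2\}]\le\exp\{1\}$. *)

theory Defs
  imports "HOL-Probability.Probability"
begin

section \<open>Composite problem and prox-mapping\<close>

text \<open>
  Functions on \<open>X\<close> are modelled by total functions of which only the values on \<open>X\<close> matter. As \<open>X\<close>
  need not be open (it may even have empty interior), derivatives are taken within \<open>X\<close>, and the
  gradient is part of the data.
\<close>

definition C1_on :: "'a::euclidean_space set \<Rightarrow> ('a \<Rightarrow> real) \<Rightarrow> ('a \<Rightarrow> 'a) \<Rightarrow> bool" where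
  "C1_on X f gradf \<longleftrightarrow>
     (\<forall>x\<in>X. (f has_derivative (\<lambda>v. gradf x \<bullet> v)) (at x within X)) \<and> continuous_on X gradf"

definition opt_value :: "'a set \<Rightarrow> ('a \<Rightarrow> real) \<Rightarrow> ('a \<Rightarrow> real) \<Rightarrow> real" where
  "opt_value X f h = (INF x\<in>X. f x + h x)"

definition D_Psi ::
  "'a set \<Rightarrow> ('a \<Rightarrow> real) \<Rightarrow> ('a \<Rightarrow> real) \<Rightarrow> real \<Rightarrow> 'a \<Rightarrow> real" where
  "D_Psi X f h L x1 = sqrt ((f x1 + h x1 - opt_value X f h) / L)"

definition bregman ::
  "('a::euclidean_space \<Rightarrow> real) \<Rightarrow> ('a \<Rightarrow> 'a) \<Rightarrow> 'a \<Rightarrow> 'a \<Rightarrow> real" where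
  "bregman \<omega> grad\<omega> x z = \<omega> x - (\<omega> z + grad\<omega> z \<bullet> (x - z))"

definition prox_objective ::
  "('a::euclidean_space \<Rightarrow> real) \<Rightarrow> ('a \<Rightarrow> real) \<Rightarrow> ('a \<Rightarrow> 'a) \<Rightarrow> 'a \<Rightarrow> 'a \<Rightarrow> real \<Rightarrow> 'a \<Rightarrow> real"
where
  "prox_objective h \<omega> grad\<omega> x g \<gamma> u = g \<bullet> u + 1 / \<gamma> * bregman \<omega> grad\<omega> u x + h u"

definition prox_map ::
  "'a::euclidean_space set \<Rightarrow> ('a \<Rightarrow> real) \<Rightarrow> ('a \<Rightarrow> real) \<Rightarrow> ('a \<Rightarrow> 'a) \<Rightarrow> 'a \<Rightarrow> 'a \<Rightarrow> real \<Rightarrow> 'a"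
where
  "prox_map X h \<omega> grad\<omega> x g \<gamma> = arg_min_on (prox_objective h \<omega> grad\<omega> x g \<gamma>) X"

definition gen_proj_grad ::
  "'a::euclidean_space set \<Rightarrow> ('a \<Rightarrow> real) \<Rightarrow> ('a \<Rightarrow> real) \<Rightarrow> ('a \<Rightarrow> 'a) \<Rightarrow> 'a \<Rightarrow> 'a \<Rightarrow> real \<Rightarrow> 'a"
where
  "gen_proj_grad X h \<omega> grad\<omega> x g \<gamma> = (1 / \<gamma>) *\<^sub>R (x - prox_map X h \<omega> grad\<omega> x g \<gamma>)"

locale composite_problem =
  fixes X :: "'a::euclidean_space set"
    and f :: "'a \<Rightarrow> real" and gradf :: "'a \<Rightarrow> 'a" and h :: "'a \<Rightarrow> real" and L :: real
  assumes X_nonempty: "X \<noteq> {}" and X_closed: "closed X" and X_convex: "convex X"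
    and f_C1: "C1_on X f gradf"
    and L_pos: "L > 0"
    and gradf_lipschitz: "\<And>x y. x \<in> X \<Longrightarrow> y \<in> X \<Longrightarrow> norm (gradf y - gradf x) \<le> L * norm (y - x)"
    and h_convex: "convex_on X h"
    and opt_value_finite: "bdd_below ((\<lambda>x. f x + h x) ` X)"

locale prox_setting = composite_problem X f gradf h L
  for X :: "'a::euclidean_space set" and f gradf h L +
  fixes \<omega> :: "'a \<Rightarrow> real" and grad\<omega> :: "'a \<Rightarrow> 'a" and \<alpha> :: real
  assumes \<alpha>_pos: "\<alpha> > 0"
    and \<omega>_C1: "C1_on X \<omega> grad\<omega>"
    and \<omega>_strong: "\<And>x z. x \<in> X \<Longrightarrow> z \<in> X \<Longrightarrow>
          (x - z) \<bullet> (grad\<omega> x - grad\<omega> z) \<ge> \<alpha> * (norm (x - z))\<^sup>2"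
    and prox_solvable: "\<And>x g \<gamma>. x \<in> X \<Longrightarrow> \<gamma> > 0 \<Longrightarrow>
          \<exists>u. is_arg_min (prox_objective h \<omega> grad\<omega> x g \<gamma>) (\<lambda>u. u \<in> X) u"


section \<open>The RSPG algorithm\<close>

definition oracle_mean ::
  "('a::real_vector \<Rightarrow> 'xi \<Rightarrow> 'a) \<Rightarrow> 'a \<Rightarrow> nat \<Rightarrow> (nat \<Rightarrow> 'xi) \<Rightarrow> 'a" where
  "oracle_mean G x m \<xi> = (1 / real m) *\<^sub>R (\<Sum>i\<in>{1..m}. G x (\<xi> i))"

text \<open>
  Iterates are numbered from \<open>1\<close>, so the value at \<open>0\<close> is irrelevant. The argument \<open>prox\<close> maps a
  point, a direction and a stepsize to the next point, and \<open>\<xi> k i\<close> is the \<open>i\<close>-th sample used at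
  the \<open>k\<close>-th iterate. With random index \<open>R\<close> the output is the iterate number \<open>R\<close>, for which only
  the samples \<open>\<xi> k i\<close> with \<open>k < R\<close> are used.
\<close>

fun rspg_iterate ::
  "('a::real_vector \<Rightarrow> 'a \<Rightarrow> real \<Rightarrow> 'a) \<Rightarrow> ('a \<Rightarrow> 'xi \<Rightarrow> 'a) \<Rightarrow> (nat \<Rightarrow> real) \<Rightarrow> (nat \<Rightarrow> nat)
    \<Rightarrow> 'a \<Rightarrow> (nat \<Rightarrow> nat \<Rightarrow> 'xi) \<Rightarrow> nat \<Rightarrow> 'a"
where
  "rspg_iterate prox G \<gamma> m x1 \<xi> 0 = x1"
| "rspg_iterate prox G \<gamma> m x1 \<xi> (Suc 0) = x1"
| "rspg_iterate prox G \<gamma> m x1 \<xi> (Suc (Suc n)) =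
     (let k = Suc n; x = rspg_iterate prox G \<gamma> m x1 \<xi> k
      in prox x (oracle_mean G x (m k) (\<xi> k)) (\<gamma> k))"

definition rspg_prob :: "real \<Rightarrow> real \<Rightarrow> (nat \<Rightarrow> real) \<Rightarrow> nat \<Rightarrow> nat \<Rightarrow> real" where
  "rspg_prob \<alpha> L \<gamma> N k = (\<alpha> * \<gamma> k - L * (\<gamma> k)\<^sup>2) / (\<Sum>j\<in>{1..N}. \<alpha> * \<gamma> j - L * (\<gamma> j)\<^sup>2)"

text \<open>The number of oracle calls of a run with random index \<open>R\<close>.\<close>

definition rspg_calls :: "(nat \<Rightarrow> nat) \<Rightarrow> nat \<Rightarrow> nat" where
  "rspg_calls m R = (\<Sum>k\<in>{1..<R}. m k)"


section \<open>The stochastic first-order oracle\<close>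

text \<open>
  The conditional expectation of a random vector, coordinate by coordinate. The library's
  \<^const>\<open>real_cond_exp\<close> is the difference of the conditional expectations of the positive and
  negative parts. It is therefore meaningful without integrability of the vector, as long as its
  norm has a finite conditional expectation almost everywhere, which the variance bound ensures.
\<close>

definition vec_cond_exp ::
  "'w measure \<Rightarrow> 'w measure \<Rightarrow> ('w \<Rightarrow> 'a::euclidean_space) \<Rightarrow> 'w \<Rightarrow> 'a" where
  "vec_cond_exp M F Y w = (\<Sum>b\<in>Basis. real_cond_exp M F (\<lambda>v. Y v \<bullet> b) w *\<^sub>R b)"

text \<open>
  \<open>Y\<close> is the oracle answer at the random point \<open>x\<close>, and \<open>F\<close> is the information available before
  the call.
\<close>

definition oracle_A1 ::
  "'w measure \<Rightarrow> 'w measure \<Rightarrow> ('a::euclidean_space \<Rightarrow> 'a) \<Rightarrow> real \<Rightarrow> ('w \<Rightarrow> 'a) \<Rightarrow> ('w \<Rightarrow> 'a) \<Rightarrow> bool"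
where
  "oracle_A1 M F gradf \<sigma> x Y \<longleftrightarrow>
     (AE w in M. vec_cond_exp M F Y w = gradf (x w)) \<and>
     (AE w in M. nn_cond_exp M F (\<lambda>v. ennreal ((norm (Y v - gradf (x v)))\<^sup>2)) w \<le> ennreal (\<sigma>\<^sup>2))"

definition oracle_A2 ::
  "'w measure \<Rightarrow> 'w measure \<Rightarrow> ('a::euclidean_space \<Rightarrow> 'a) \<Rightarrow> real \<Rightarrow> ('w \<Rightarrow> 'a) \<Rightarrow> ('w \<Rightarrow> 'a) \<Rightarrow> bool"
where
  "oracle_A2 M F gradf \<sigma> x Y \<longleftrightarrow>
     (AE w in M. nn_cond_exp M F (\<lambda>v. ennreal (exp ((norm (Y v - gradf (x v)))\<^sup>2 / \<sigma>\<^sup>2))) w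
        \<le> ennreal (exp 1))"


section \<open>The two-phase algorithm\<close>

definition batch_size :: "real \<Rightarrow> real \<Rightarrow> real \<Rightarrow> nat \<Rightarrow> nat" where
  "batch_size L \<sigma> Dt Nbar =
     nat \<lceil>min (max 1 (\<sigma> * sqrt (6 * real Nbar) / (4 * L * Dt))) (real Nbar)\<rceil>"

definition iteration_limit :: "real \<Rightarrow> real \<Rightarrow> real \<Rightarrow> nat \<Rightarrow> nat" where
  "iteration_limit L \<sigma> Dt Nbar = nat \<lfloor>real Nbar / real (batch_size L \<sigma> Dt Nbar)\<rfloor>"

definition two_rspg_calls ::
  "real \<Rightarrow> real \<Rightarrow> real \<Rightarrow> nat \<Rightarrow> nat \<Rightarrow> nat \<Rightarrow> (nat \<Rightarrow> nat) \<Rightarrow> nat" where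
  "two_rspg_calls L \<sigma> Dt S Nbar T R =
     (\<Sum>s\<in>{1..S}. rspg_calls (\<lambda>_. batch_size L \<sigma> Dt Nbar) (R s)) + (\<Sum>s\<in>{1..S}. T)"

text \<open>
  The randomness consists of the random index \<open>R s\<close> of run \<open>s\<close>, the \<open>i\<close>-th sample \<open>\<xi> s k i\<close> at the
  \<open>k\<close>-th iterate of run \<open>s\<close>, and the \<open>k\<close>-th post-optimization sample \<open>\<zeta> s k\<close> at the candidate of
  run \<open>s\<close>. Samples take values in the measurable space \<open>\<Xi>\<close>; its measure plays no role.
\<close>

locale two_rspg_algorithm = prox_setting X f gradf h L \<omega> grad\<omega> \<alpha>
  for X :: "'a::euclidean_space set" and f gradf h L \<omega> grad\<omega> \<alpha> +
  fixes M :: "'w measure" and \<Xi> :: "'xi measure"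
    and G :: "'a \<Rightarrow> 'xi \<Rightarrow> 'a"
    and \<sigma> Dt :: real and x1 :: 'a and S Nbar T :: nat
    and R :: "nat \<Rightarrow> 'w \<Rightarrow> nat"
    and \<xi> :: "nat \<Rightarrow> nat \<Rightarrow> nat \<Rightarrow> 'w \<Rightarrow> 'xi"
    and \<zeta> :: "nat \<Rightarrow> nat \<Rightarrow> 'w \<Rightarrow> 'xi"
begin

definition m :: nat where "m = batch_size L \<sigma> Dt Nbar"

definition N :: nat where "N = iteration_limit L \<sigma> Dt Nbar"

definition \<gamma> :: real where "\<gamma> = \<alpha> / (2 * L)"

definition iterate :: "nat \<Rightarrow> nat \<Rightarrow> 'w \<Rightarrow> 'a" where
  "iterate s k w =
     rspg_iterate (prox_map X h \<omega> grad\<omega>) G (\<lambda>_. \<gamma>) (\<lambda>_. m) x1 (\<lambda>k i. \<xi> s k i w) k"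

definition xbar :: "nat \<Rightarrow> 'w \<Rightarrow> 'a" where
  "xbar s w = iterate s (R s w) w"

definition gbar :: "nat \<Rightarrow> 'w \<Rightarrow> 'a" where
  "gbar s w =
     gen_proj_grad X h \<omega> grad\<omega> (xbar s w) (oracle_mean G (xbar s w) T (\<lambda>k. \<zeta> s k w)) (\<alpha> / (2 * L))"

text \<open>
  A run stops before iteration \<open>N\<close>, so oracle calls happen at iterates \<open>k < N\<close> only. The function
  \<open>samples s I\<close> collects the samples of run \<open>s\<close> with indices in \<open>I\<close>, and \<open>earlier k i\<close> indexes the
  samples of a run drawn before the \<open>i\<close>-th call at the \<open>k\<close>-th iterate. As \<open>x1\<close> is deterministic,
  these samples determine the \<open>k\<close>-th iterate.
\<close>

definition samples :: "nat \<Rightarrow> (nat \<times> nat) set \<Rightarrow> 'w \<Rightarrow> nat \<times> nat \<Rightarrow> 'xi" where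
  "samples s I w = restrict (\<lambda>(k, i). \<xi> s k i w) I"

definition run_calls :: "(nat \<times> nat) set" where
  "run_calls = {1..<N} \<times> {1..m}"

definition earlier :: "nat \<Rightarrow> nat \<Rightarrow> (nat \<times> nat) set" where
  "earlier k i = {1..<k} \<times> {1..m} \<union> {k} \<times> {1..<i}"

definition history :: "nat \<Rightarrow> nat \<Rightarrow> nat \<Rightarrow> 'w measure" where
  "history s k i =
     vimage_algebra (space M) (samples s (earlier k i)) (PiM (earlier k i) (\<lambda>_. \<Xi>))"

text \<open>The information generated by all candidates and the first \<open>k - 1\<close> post-optimization samples
  at candidate \<open>s\<close>.\<close>

definition post_history :: "nat \<Rightarrow> nat \<Rightarrow> 'w measure" where
  "post_history s k =
     vimage_algebra (space M)
       (\<lambda>w. (restrict (\<lambda>s'. xbar s' w) {1..S}, restrict (\<lambda>j. \<zeta> s j w) {1..<k}))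
       (PiM {1..S} (\<lambda>_. borel) \<Otimes>\<^sub>M PiM {1..<k} (\<lambda>_. \<Xi>))"

end

locale two_rspg =
  two_rspg_algorithm X f gradf h L \<omega> grad\<omega> \<alpha> M \<Xi> G \<sigma> Dt x1 S Nbar T R \<xi> \<zeta> + prob_space M
  for X :: "'a::euclidean_space set" and f gradf h L \<omega> grad\<omega> \<alpha>
    and M :: "'w measure" and \<Xi> :: "'xi measure" and G \<sigma> Dt x1 S Nbar T R \<xi> \<zeta> +
  fixes xstar :: "'w \<Rightarrow> 'a"
  assumes \<sigma>_pos: "\<sigma> > 0" and Dt_pos: "Dt > 0" and x1_in: "x1 \<in> X"
    and S_pos: "S \<ge> 1" and Nbar_pos: "Nbar \<ge> 1" and T_pos: "T \<ge> 1"
    and G_measurable: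
      "(\<lambda>(x, y). G x y) \<in> borel_measurable (restrict_space borel X \<Otimes>\<^sub>M \<Xi>)"
    \<comment> \<open>the optimization phase\<close>
    and R_measurable: "\<And>s. s \<in> {1..S} \<Longrightarrow> R s \<in> measurable M (count_space UNIV)"
    and R_range: "\<And>s w. s \<in> {1..S} \<Longrightarrow> w \<in> space M \<Longrightarrow> R s w \<in> {1..N}"
    and R_prob: "\<And>s k. s \<in> {1..S} \<Longrightarrow> k \<in> {1..N} \<Longrightarrow>
          \<P>(w in M. R s w = k) = rspg_prob \<alpha> L (\<lambda>_. \<gamma>) N k"
    and \<xi>_measurable: "\<And>s k i. s \<in> {1..S} \<Longrightarrow> (k, i) \<in> run_calls \<Longrightarrow> \<xi> s k i \<in> measurable M \<Xi>"
    and R_indep: "\<And>s. s \<in> {1..S} \<Longrightarrow>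
          indep_set (sets (vimage_algebra (space M) (R s) (count_space UNIV)))
            (sets (vimage_algebra (space M) (samples s run_calls) (PiM run_calls (\<lambda>_. \<Xi>))))"
    and runs_indep:
          "indep_vars (\<lambda>_. count_space UNIV \<Otimes>\<^sub>M PiM run_calls (\<lambda>_. \<Xi>))
             (\<lambda>s w. (R s w, samples s run_calls w)) {1..S}"
    and opt_A1: "\<And>s k i. s \<in> {1..S} \<Longrightarrow> (k, i) \<in> run_calls \<Longrightarrow>
          oracle_A1 M (history s k i) gradf \<sigma> (iterate s k) (\<lambda>w. G (iterate s k w) (\<xi> s k i w))"
    and opt_A2: "\<And>s k i. s \<in> {1..S} \<Longrightarrow> (k, i) \<in> run_calls \<Longrightarrow>
          oracle_A2 M (history s k i) gradf \<sigma> (iterate s k) (\<lambda>w. G (iterate s k w) (\<xi> s k i w))"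
    \<comment> \<open>the post-optimization phase\<close>
    and \<zeta>_measurable: "\<And>s k. s \<in> {1..S} \<Longrightarrow> k \<in> {1..T} \<Longrightarrow> \<zeta> s k \<in> measurable M \<Xi>"
    and post_A1: "\<And>s k. s \<in> {1..S} \<Longrightarrow> k \<in> {1..T} \<Longrightarrow>
          oracle_A1 M (post_history s k) gradf \<sigma> (xbar s) (\<lambda>w. G (xbar s w) (\<zeta> s k w))"
    and post_A2: "\<And>s k. s \<in> {1..S} \<Longrightarrow> k \<in> {1..T} \<Longrightarrow>
          oracle_A2 M (post_history s k) gradf \<sigma> (xbar s) (\<lambda>w. G (xbar s w) (\<zeta> s k w))"
    \<comment> \<open>the output, with an arbitrary measurable resolution of ties\<close>
    and xstar_measurable: "xstar \<in> borel_measurable M"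
    and xstar_output: "\<And>w. w \<in> space M \<Longrightarrow>
          \<exists>s\<in>{1..S}. xstar w = xbar s w \<and> norm (gbar s w) = (MIN s'\<in>{1..S}. norm (gbar s' w))"


section \<open>The constants of the complexity bounds\<close>

text \<open>Here \<open>D\<close> stands for the value of \<^const>\<open>D_Psi\<close>.\<close>

definition B_Nbar :: "real \<Rightarrow> real \<Rightarrow> real \<Rightarrow> real \<Rightarrow> nat \<Rightarrow> real" where
  "B_Nbar L \<sigma> Dt D Nbar =
     16 * L * D\<^sup>2 / real Nbar
     + 4 * sqrt 6 * \<sigma> / sqrt (real Nbar)
       * (D\<^sup>2 / Dt + Dt * max 1 (sqrt 6 * \<sigma> / (4 * L * Dt * sqrt (real Nbar))))"

definition S_of :: "real \<Rightarrow> nat" where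
  "S_of \<Lambda> = nat \<lceil>log 2 (2 / \<Lambda>)\<rceil>"

definition Nbar_of :: "real \<Rightarrow> real \<Rightarrow> real \<Rightarrow> real \<Rightarrow> real \<Rightarrow> real \<Rightarrow> nat" where
  "Nbar_of \<alpha> L \<sigma> Dt D \<epsilon> =
     nat \<lceil>Max {512 * L\<^sup>2 * D\<^sup>2 / (\<alpha>\<^sup>2 * \<epsilon>),
               ((Dt + D\<^sup>2 / Dt) * (128 * sqrt 6 * L * \<sigma> / (\<alpha>\<^sup>2 * \<epsilon>)))\<^sup>2,
               3 * \<sigma>\<^sup>2 / (8 * L\<^sup>2 * Dt\<^sup>2)}\<rceil>"

definition T_of :: "real \<Rightarrow> real \<Rightarrow> real \<Rightarrow> real \<Rightarrow> nat" where
  "T_of \<alpha> \<sigma> \<epsilon> \<Lambda> =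
     nat \<lceil>24 * \<sigma>\<^sup>2 / (\<alpha>\<^sup>2 * \<epsilon>) * (1 + sqrt (3 * log 2 (2 * real (S_of \<Lambda>) / \<Lambda>)))\<^sup>2\<rceil>"

end

theory Submission
  imports Defs
begin

text \<open>
  One prox-step with the error \<open>\<delta>\<close> in the gradient decreases \<open>f + h\<close> by
  \<open>\<alpha>\<^sup>2 / (8 L)\<close> times the squared norm of the exact projected gradient \<open>g\<close>, up to
  \<open>\<gamma> (\<delta> \<bullet> g) + 3 / (4 L) \<parallel>\<delta>\<parallel>\<^sup>2\<close>. Telescoping and averaging over the random index bounds the
  expected squared projected gradient at a candidate by \<open>L B / \<alpha>\<^sup>2\<close>, so by Markov's inequality
  and independence all candidates exceed twice this bound with probability at most \<open>2\<close> to the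
  power \<open>-S\<close>. Since the prox-mapping is Lipschitz in the direction, the error of the
  post-optimization estimate is controlled by a sum of vector-valued martingale differences.
  Its dimension-free tail bound comes from the exponential supermartingale
  \<open>cosh (c \<parallel>Z\<parallel>)\<close>, with \<open>Z\<close> the partial sum, for moderate deviations, from Chebyshev's
  inequality for small ones, and from the exponential moment of the sum of squares for large ones.
\<close>

section \<open>A tail bound for vector-valued martingales\<close>

text \<open>The tail bound must hold with prefactor 1 for every \<open>l > 0\<close>. The
  supermartingale alone leaves a prefactor 2 and needs \<open>c * \<sigma> \<le> 1\<close>, because
  A2 controls exponential moments only up to the exponent \<open>1 / \<sigma>\<^sup>2\<close>. This
  forces the three ranges of \<open>l\<close>. A second obstacle is integrability. To average the
  product of noise and projected gradient, the projected gradient at a random iterate has to be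
  square integrable. This is obtained by induction from the same telescoped inequality that is
  averaged afterwards. The constants 8 and 12 arise when the selected candidate is compared with a
  good one through their estimated gradients. The bound \<open>norm_sq_le_twice\<close> is used once
  at each of the two, so the threshold of the good candidate is multiplied by 4 and the two squared
  estimation errors by 4 and 2. The threshold is \<open>2 * L * B / \<alpha>\<^sup>2\<close>, and
  each squared error is below \<open>2 * (1 + l)\<^sup>2 * \<sigma>\<^sup>2 / (T *
  \<alpha>\<^sup>2)\<close>.\<close>

lemma cosh_sqrt_convex:
  fixes u v p q :: real
  assumes "p \<ge> 0" "q \<ge> 0" "p + q = 1"
  shows "cosh (sqrt (p * u\<^sup>2 + q * v\<^sup>2)) \<le> p * cosh u + q * cosh v"
\<comment> \<open>As a power series in y, \<open>cosh (sqrt y)\<close> has nonnegative coefficients,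
  and every power of y is convex for y \<ge> 0. Hence the convexity inequality holds term by
  term.\<close>
proof (rule sums_le[OF _ cosh_converges])
  show "(\<lambda>n. p * (if even n then u ^ n /\<^sub>R fact n else 0) + q * (if even n then v ^ n /\<^sub>R fact n else 0))
      sums (p * cosh u + q * cosh v)"
    by (intro sums_add sums_mult cosh_converges)
next
  fix n :: nat
  show "(if even n then sqrt (p * u\<^sup>2 + q * v\<^sup>2) ^ n /\<^sub>R fact n else 0)
      \<le> p * (if even n then u ^ n /\<^sub>R fact n else 0) + q * (if even n then v ^ n /\<^sub>R fact n else 0)"
  proof (cases "even n")
    case True
    then obtain k where n: "n = 2 * k" by (rule evenE)
    have convex: "convex_on {0..} (\<lambda>x::real. x ^ k)"
      by (cases "even k") (auto intro: convex_power_odd convex_on_subset[OF convex_power_even])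
    have p: "p = 1 - q" using assms by simp
    have "(p * u\<^sup>2 + q * v\<^sup>2) ^ k \<le> p * u ^ n + q * v ^ n"
      using convex_onD[OF convex, of q "u\<^sup>2" "v\<^sup>2"] assms(1,2) unfolding p by (simp add: n power_mult)
    moreover have "sqrt (p * u\<^sup>2 + q * v\<^sup>2) ^ n = (p * u\<^sup>2 + q * v\<^sup>2) ^ k"
      using assms by (simp add: n power_mult)
    ultimately have "sqrt (p * u\<^sup>2 + q * v\<^sup>2) ^ n /\<^sub>R fact n \<le> (p * u ^ n + q * v ^ n) /\<^sub>R fact n"
      by (intro scaleR_left_mono) auto
    then show ?thesis using True by (simp add: distrib_left mult.left_commute)
  qed simp
qed

lemma sinh_ge_self:
  fixes b :: real
  assumes "b \<ge> 0"
  shows "b \<le> sinh b"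
proof -
  have "((\<lambda>x. sinh x - x) has_real_derivative (cosh x - 1)) (at x)" for x :: real
    by (auto intro!: derivative_eq_intros)
  moreover have "0 \<le> cosh x - 1" for x :: real using cosh_real_ge_1[of x] by simp
  ultimately have "sinh 0 - 0 \<le> sinh b - b"
    using DERIV_nonneg_imp_nondecreasing[OF assms, of "\<lambda>x. sinh x - x"] by blast
  then show ?thesis by simp
qed

text \<open>The linear term is taken out of \<open>exp\<close> because it belongs to the part of the
  increment that averages to zero. What remains is of second order, which is the form that an
  exponential moment of a square can control.\<close>

lemma exp_minus_self_le:
  fixes b :: real
  assumes "b \<ge> 0"
  shows "exp b - b \<le> exp (b\<^sup>2)"
proof (cases "b \<le> 1")
  case True
  then have "exp b \<le> 1 + b + b\<^sup>2" using assms by (intro exp_bound)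
  then show ?thesis using exp_ge_add_one_self[of "b\<^sup>2"] by linarith
next
  case False
  then have "b * 1 \<le> b * b" by (intro mult_left_mono) auto
  then have "exp b \<le> exp (b\<^sup>2)" by (simp add: power2_eq_square)
  then show ?thesis using assms by linarith
qed

text \<open>For fixed norms of \<open>x\<close> and \<open>z\<close> the left side is convex and the right side affine in \<open>x \<bullet> z\<close>,
  which reduces the inequality to collinear vectors.\<close>

lemma cosh_norm_add_le:
  fixes x z :: "'a::real_inner"
  shows "cosh (norm (x + z)) \<le> cosh (norm x) * exp ((norm z)\<^sup>2) + sinh (norm x) / norm x * (x \<bullet> z)"
proof -
  define a b where ab: "a = norm x" "b = norm z"
  define t where "t = x \<bullet> z / (a * b)"
  have abs_t: "\<bar>t\<bar> \<le> 1"
    using Cauchy_Schwarz_ineq2[of x z] by (auto simp: t_def ab divide_le_eq)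
  have xz: "x \<bullet> z = t * a * b" by (auto simp: t_def ab)
  have "(norm (x + z))\<^sup>2 = a\<^sup>2 + b\<^sup>2 + 2 * (t * a * b)"
    unfolding xz[symmetric] by (simp add: ab power2_norm_eq_inner inner_simps inner_commute)
  also have "\<dots> = (1 + t) / 2 * (a + b)\<^sup>2 + (1 - t) / 2 * (a - b)\<^sup>2"
    by (simp add: power2_eq_square field_simps)
  finally have sq: "(norm (x + z))\<^sup>2 = (1 + t) / 2 * (a + b)\<^sup>2 + (1 - t) / 2 * (a - b)\<^sup>2" .
  have "norm (x + z) = sqrt ((1 + t) / 2 * (a + b)\<^sup>2 + (1 - t) / 2 * (a - b)\<^sup>2)"
    unfolding sq[symmetric] by simp
  also have "cosh \<dots> \<le> (1 + t) / 2 * cosh (a + b) + (1 - t) / 2 * cosh (a - b)"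
    using abs_t by (intro cosh_sqrt_convex) (auto simp: field_simps)
  also have "\<dots> = cosh a * cosh b + t * sinh a * sinh b"
    unfolding cosh_add cosh_diff by (simp add: algebra_simps add_divide_distrib diff_divide_distrib)
  \<comment> \<open>Only the linear part \<open>b\<close> of \<open>sinh b\<close> stays attached to
    the signed factor \<open>t\<close>, where it becomes a multiple of the inner product. The excess
    \<open>sinh b - b\<close> is nonnegative and is bounded using
    \<open>t * sinh a \<le> cosh a\<close>.\<close>
  also have "\<dots> \<le> cosh a * (exp b - b) + t * b * sinh a"
  proof -
    have "0 \<le> sinh a" using ab by simp
    then have "t * sinh a \<le> 1 * sinh a" using abs_t by (intro mult_right_mono) auto
    also have "\<dots> \<le> cosh a" using sinh_less_cosh_real[of a] by simp
    finally have "t * sinh a * (sinh b - b) \<le> cosh a * (sinh b - b)"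
      using sinh_ge_self[of b] ab by (intro mult_right_mono) auto
    moreover have "exp b = cosh b + sinh b" by (simp add: cosh_plus_sinh)
    ultimately show ?thesis by (simp add: algebra_simps)
  qed
  also have "cosh a * (exp b - b) \<le> cosh a * exp (b\<^sup>2)"
    using exp_minus_self_le[of b] ab by (intro mult_left_mono) auto
  also have "t * b * sinh a = sinh a / a * (x \<bullet> z)" unfolding xz by (cases "a = 0") auto
  finally show ?thesis by (simp add: ab)
qed

lemma self_le_exp_square:
  fixes t :: real
  assumes "t \<ge> 0"
  shows "t \<le> exp (t\<^sup>2)"
proof -
  have "2 * t \<le> t\<^sup>2 + 1" using sum_squares_bound[of t 1] by simp
  then show ?thesis using exp_ge_add_one_self[of "t\<^sup>2"] assms by linarith
qed

text \<open>With \<open>y = exp s\<close>, the concave function \<open>y powr q\<close> lies below its tangent at \<open>exp 1\<close>.\<close>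

lemma exp_mult_le:
  fixes q s :: real
  assumes "0 \<le> q" "q \<le> 1"
  shows "exp (q * s) \<le> exp q * (1 - q) + q * exp (q - 1) * exp s"
proof -
  have "exp ((1 - q) *\<^sub>R 0 + q *\<^sub>R (s - 1)) \<le> (1 - q) * exp 0 + q * exp (s - 1)"
    by (rule convex_onD[OF exp_convex]) (use assms in auto)
  then have "exp q * exp (q * (s - 1)) \<le> exp q * (1 - q + q * exp (s - 1))"
    by (intro mult_left_mono) auto
  also have "exp q * exp (q * (s - 1)) = exp (q * s)" by (simp add: algebra_simps flip: exp_add)
  also have "exp q * (1 - q + q * exp (s - 1)) = exp q * (1 - q) + q * exp (q - 1) * exp s"
    by (simp add: exp_diff distrib_left mult_ac)
  finally show ?thesis .
qed

lemma integrable_inner_of_squares: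
  fixes u v :: "'w \<Rightarrow> 'a::euclidean_space"
  assumes [measurable]: "u \<in> borel_measurable M" "v \<in> borel_measurable M"
    and "integrable M (\<lambda>w. (norm (u w))\<^sup>2)" "integrable M (\<lambda>w. (norm (v w))\<^sup>2)"
  shows "integrable M (\<lambda>w. u w \<bullet> v w)"
proof (rule Bochner_Integration.integrable_bound[OF Bochner_Integration.integrable_add[OF assms(3,4)]])
  have "\<bar>u w \<bullet> v w\<bar> \<le> (norm (u w))\<^sup>2 + (norm (v w))\<^sup>2" for w
    using Cauchy_Schwarz_ineq2[of "u w" "v w"] sum_squares_bound[of "norm (u w)" "norm (v w)"]
      mult_nonneg_nonneg[of "norm (u w)" "norm (v w)"] by simp
  then show "AE w in M. norm (u w \<bullet> v w) \<le> norm ((norm (u w))\<^sup>2 + (norm (v w))\<^sup>2)" by simp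
qed measurable

text \<open>Conditional statements are expressed through integrals against
  \<open>F k\<close>-measurable weights, the form in which they are applied below. The weight in
  \<open>centered\<close> may be unbounded, so integrability of the product is a premise there. The
  same interface serves the errors within one batch and the post-optimization errors at one
  candidate.\<close>

locale noise_sequence = prob_space M
  for M :: "'w measure" +
  fixes F :: "nat \<Rightarrow> 'w measure" and \<delta> :: "nat \<Rightarrow> 'w \<Rightarrow> 'a::euclidean_space" and \<sigma> :: real and n :: nat
  assumes \<sigma>_pos: "\<sigma> > 0"
    and subalg: "\<And>k. k \<in> {1..n} \<Longrightarrow> subalgebra M (F k)"
    and noise_measurable: "\<And>k. k \<in> {1..n} \<Longrightarrow> \<delta> k \<in> borel_measurable M"
    and adapted: "\<And>j k. k \<in> {1..n} \<Longrightarrow> j \<in> {1..<k} \<Longrightarrow> \<delta> j \<in> borel_measurable (F k)"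
    and centered: "\<And>k v. k \<in> {1..n} \<Longrightarrow> v \<in> borel_measurable (F k) \<Longrightarrow>
          integrable M (\<lambda>w. v w \<bullet> \<delta> k w) \<Longrightarrow> (\<integral>w. v w \<bullet> \<delta> k w \<partial>M) = 0"
    and square_integrable: "\<And>k. k \<in> {1..n} \<Longrightarrow> integrable M (\<lambda>w. (norm (\<delta> k w))\<^sup>2)"
    and square_bound: "\<And>k. k \<in> {1..n} \<Longrightarrow> (\<integral>w. (norm (\<delta> k w))\<^sup>2 \<partial>M) \<le> \<sigma>\<^sup>2"
    and exp_square_integrable: "\<And>k u. k \<in> {1..n} \<Longrightarrow> u \<in> borel_measurable (F k) \<Longrightarrow>
          (\<And>w. 0 \<le> u w) \<Longrightarrow> integrable M u \<Longrightarrow>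
          integrable M (\<lambda>w. u w * exp ((norm (\<delta> k w))\<^sup>2 / \<sigma>\<^sup>2))"
    and exp_square_bound: "\<And>k u. k \<in> {1..n} \<Longrightarrow> u \<in> borel_measurable (F k) \<Longrightarrow>
          (\<And>w. 0 \<le> u w) \<Longrightarrow> integrable M u \<Longrightarrow>
          (\<integral>w. u w * exp ((norm (\<delta> k w))\<^sup>2 / \<sigma>\<^sup>2) \<partial>M) \<le> exp 1 * (\<integral>w. u w \<partial>M)"
begin

abbreviation partial :: "nat \<Rightarrow> 'w \<Rightarrow> 'a" where
  "partial k w \<equiv> \<Sum>j\<in>{1..k}. \<delta> j w"

lemma partial_adapted: "Suc k \<le> n \<Longrightarrow> partial k \<in> borel_measurable (F (Suc k))"
  using adapted[of "Suc k"] by (intro borel_measurable_sum) auto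

lemma partial_measurable: "k \<le> n \<Longrightarrow> partial k \<in> borel_measurable M"
  using noise_measurable by (intro borel_measurable_sum) auto

lemma partial_square:
  assumes "k \<le> n"
  shows "integrable M (\<lambda>w. (norm (partial k w))\<^sup>2) \<and> (\<integral>w. (norm (partial k w))\<^sup>2 \<partial>M) \<le> real k * \<sigma>\<^sup>2"
  using assms
proof (induction k)
  case (Suc k)
  have k: "Suc k \<in> {1..n}" "k \<le> n" using Suc by auto
  note IH = Suc.IH[OF k(2)]
  have cross: "integrable M (\<lambda>w. partial k w \<bullet> \<delta> (Suc k) w)"
    using k IH square_integrable noise_measurable partial_measurable
    by (intro integrable_inner_of_squares) auto
  have sq: "(norm (partial (Suc k) w))\<^sup>2
      = (norm (partial k w))\<^sup>2 + 2 * (partial k w \<bullet> \<delta> (Suc k) w) + (norm (\<delta> (Suc k) w))\<^sup>2" for w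
    by (simp add: power2_norm_eq_inner inner_simps inner_commute)
  have "(\<integral>w. partial k w \<bullet> \<delta> (Suc k) w \<partial>M) = 0"
    using k cross partial_adapted[of k] by (intro centered) auto
  then show ?case
    unfolding sq using IH cross square_integrable[OF k(1)] square_bound[OF k(1)]
    by (simp add: algebra_simps)
qed simp

text \<open>Each increment multiplies the expectation by at most
  \<open>exp ((c * \<sigma>)\<^sup>2)\<close>. By \<open>cosh_norm_add_le\<close> the new value is
  bounded by the old one times the exponential of a square, plus a term linear in the increment with
  an adapted coefficient, which integrates to zero.\<close>

lemma cosh_partial:
  assumes "c > 0" "c * \<sigma> \<le> 1" "k \<le> n"
  shows "integrable M (\<lambda>w. cosh (c * norm (partial k w))) \<and>
    (\<integral>w. cosh (c * norm (partial k w)) \<partial>M) \<le> exp (real k * (c * \<sigma>)\<^sup>2)"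
  using assms(3)
proof (induction k)
  case (Suc k)
  have k: "Suc k \<in> {1..n}" "k \<le> n" using Suc by auto
  define P where "P = partial k"
  define Y where "Y = \<delta> (Suc k)"
  have S: "partial (Suc k) w = P w + Y w" for w by (simp add: P_def Y_def)
  have IH: "integrable M (\<lambda>w. cosh (c * norm (P w)))"
    "(\<integral>w. cosh (c * norm (P w)) \<partial>M) \<le> exp (real k * (c * \<sigma>)\<^sup>2)"
    using Suc.IH[OF k(2)] by (auto simp: P_def)
  let ?u = "\<lambda>w. cosh (c * norm (P w))"
  let ?d = "\<lambda>w. norm (Y w)"
  let ?q = "(c * \<sigma>)\<^sup>2"
  \<comment> \<open>The gradient of \<open>cosh (c * norm x)\<close> at \<open>P w\<close>. At the
    origin the quotient is 0 by the convention on division, which is also the correct value of the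
    gradient.\<close>
  define v where "v w = (c * sinh (c * norm (P w)) / norm (P w)) *\<^sub>R P w" for w
  have c2: "c\<^sup>2 \<le> 1 / \<sigma>\<^sup>2"
    using power_mono[OF assms(2), of 2] assms(1) \<sigma>_pos by (simp add: power_mult_distrib field_simps)
  have q: "?q \<le> 1" using power_mono[OF assms(2), of 2] assms(1) \<sigma>_pos by simp
  have [measurable]: "(cosh :: real \<Rightarrow> real) \<in> borel_measurable borel"
    "(sinh :: real \<Rightarrow> real) \<in> borel_measurable borel"
    by (auto intro!: borel_measurable_continuous_onI continuous_intros)
  have U: "(\<lambda>x::'a. cosh (c * norm x)) \<in> borel_measurable borel"
    "(\<lambda>x::'a. (c * sinh (c * norm x) / norm x) *\<^sub>R x) \<in> borel_measurable borel"
    by measurable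
  note [measurable] = noise_measurable[OF k(1), folded Y_def] partial_measurable[OF k(2), folded P_def]
  have PF: "P \<in> borel_measurable (F (Suc k))" using partial_adapted[of k] k by (simp add: P_def)
  have uF: "?u \<in> borel_measurable (F (Suc k))" "v \<in> borel_measurable (F (Suc k))"
    unfolding v_def using measurable_compose[OF PF U(1)] measurable_compose[OF PF U(2)] by auto
  have [measurable]: "v \<in> borel_measurable M" unfolding v_def by measurable
  have b: "integrable M (\<lambda>w. ?u w * exp ((?d w)\<^sup>2 / \<sigma>\<^sup>2))"
    "(\<integral>w. ?u w * exp ((?d w)\<^sup>2 / \<sigma>\<^sup>2) \<partial>M) \<le> exp 1 * (\<integral>w. ?u w \<partial>M)"
    using exp_square_integrable[OF k(1) uF(1)] exp_square_bound[OF k(1) uF(1)] IH by (auto simp: Y_def)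
  have pw: "cosh (c * norm ((P w + Y w))) \<le> ?u w * exp (c\<^sup>2 * (?d w)\<^sup>2) + v w \<bullet> Y w" for w
  proof -
    have v: "v w \<bullet> Y w = sinh (norm (c *\<^sub>R P w)) / norm (c *\<^sub>R P w)
        * ((c *\<^sub>R P w) \<bullet> (c *\<^sub>R Y w))"
      using assms(1) by (cases "P w = 0") (auto simp: v_def)
    have "cosh (c * norm ((P w + Y w))) = cosh (norm (c *\<^sub>R P w + c *\<^sub>R Y w))"
      using assms(1) by (simp flip: scaleR_add_right)
    also have "\<dots> \<le> ?u w * exp (c\<^sup>2 * (?d w)\<^sup>2) + v w \<bullet> Y w"
      using cosh_norm_add_le[of "c *\<^sub>R P w" "c *\<^sub>R Y w"] assms(1)
      unfolding v by (simp add: power_mult_distrib)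
    finally show ?thesis .
  qed
  have le: "?u w * exp (c\<^sup>2 * (?d w)\<^sup>2) \<le> ?u w * exp ((?d w)\<^sup>2 / \<sigma>\<^sup>2)" for w
    using mult_right_mono[OF c2, of "(?d w)\<^sup>2"] by (intro mult_left_mono) auto
  have a: "integrable M (\<lambda>w. ?u w * exp (c\<^sup>2 * (?d w)\<^sup>2))"
    by (intro Bochner_Integration.integrable_bound[OF b(1)] AE_I2) (measurable, use le in \<open>simp add: abs_mult\<close>)
  \<comment> \<open>The norm of \<open>v w\<close> is at most \<open>c * ?u w\<close>, so
    \<open>self_le_exp_square\<close> bounds the linear term by the exponential one. This supplies
    the integrability that \<open>centered\<close> asks for.\<close>
  have le: "\<bar>v w \<bullet> Y w\<bar> \<le> ?u w * exp (c\<^sup>2 * (?d w)\<^sup>2)" for w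
  proof -
    have "\<bar>v w \<bullet> Y w\<bar> \<le> norm (v w) * ?d w" by (rule Cauchy_Schwarz_ineq2)
    also have "\<dots> \<le> c * ?u w * ?d w"
    proof (rule mult_right_mono)
      show "norm (v w) \<le> c * ?u w"
        using assms(1) sinh_less_cosh_real[of "c * norm (P w)"] by (auto simp: v_def abs_mult)
    qed simp
    also have "\<dots> = ?u w * (c * ?d w)" by simp
    also have "\<dots> \<le> ?u w * exp (c\<^sup>2 * (?d w)\<^sup>2)"
      using self_le_exp_square[of "c * ?d w"] assms(1)
      by (intro mult_left_mono) (simp_all add: power_mult_distrib)
    finally show ?thesis .
  qed
  have i: "integrable M (\<lambda>w. v w \<bullet> Y w)"
    by (intro Bochner_Integration.integrable_bound[OF a] AE_I2) (measurable, use le in \<open>simp add: abs_mult\<close>)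
  have ib: "integrable M (\<lambda>w. ?u w * exp (c\<^sup>2 * (?d w)\<^sup>2) + v w \<bullet> Y w)"
    using a i by simp
  have int: "integrable M (\<lambda>w. cosh (c * norm ((P w + Y w))))"
    by (intro Bochner_Integration.integrable_bound[OF ib] AE_I2)
      (measurable, simp add: order_trans[OF pw abs_ge_self])
  have "(\<integral>w. cosh (c * norm ((P w + Y w))) \<partial>M) \<le> (\<integral>w. ?u w * exp (c\<^sup>2 * (?d w)\<^sup>2) + v w \<bullet> Y w \<partial>M)"
    using pw by (intro integral_mono int ib)
  also have "\<dots> = (\<integral>w. ?u w * exp (c\<^sup>2 * (?d w)\<^sup>2) \<partial>M)"
    using a i centered[OF k(1) uF(2)] by (simp add: Y_def)
  \<comment> \<open>The tangent bound replaces the exponent \<open>c\<^sup>2\<close> by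
    \<open>1 / \<sigma>\<^sup>2\<close>, where A2 applies. Touching at \<open>exp 1\<close> is what
    makes the constant sharp: with the factor \<open>exp 1\<close> from A2 the two coefficients add
    up to exactly \<open>exp ?q\<close>.\<close>
  also have "\<dots> \<le> (\<integral>w. exp ?q * (1 - ?q) * ?u w + ?q * exp (?q - 1) * (?u w * exp ((?d w)\<^sup>2 / \<sigma>\<^sup>2)) \<partial>M)"
  proof (intro integral_mono a)
    show "integrable M (\<lambda>w. exp ?q * (1 - ?q) * ?u w + ?q * exp (?q - 1) * (?u w * exp ((?d w)\<^sup>2 / \<sigma>\<^sup>2)))"
      using IH b by simp
    fix w
    have "exp (?q * ((?d w)\<^sup>2 / \<sigma>\<^sup>2)) = exp (c\<^sup>2 * (?d w)\<^sup>2)"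
      using \<sigma>_pos by (simp add: power_mult_distrib)
    then have "?u w * exp (c\<^sup>2 * (?d w)\<^sup>2)
        \<le> ?u w * (exp ?q * (1 - ?q) + ?q * exp (?q - 1) * exp ((?d w)\<^sup>2 / \<sigma>\<^sup>2))"
      using exp_mult_le[of ?q "(?d w)\<^sup>2 / \<sigma>\<^sup>2"] q by (intro mult_left_mono) auto
    then show "?u w * exp (c\<^sup>2 * (?d w)\<^sup>2)
        \<le> exp ?q * (1 - ?q) * ?u w + ?q * exp (?q - 1) * (?u w * exp ((?d w)\<^sup>2 / \<sigma>\<^sup>2))"
      by (simp add: algebra_simps)
  qed
  also have "\<dots> = exp ?q * (1 - ?q) * (\<integral>w. ?u w \<partial>M)
      + ?q * exp (?q - 1) * (\<integral>w. ?u w * exp ((?d w)\<^sup>2 / \<sigma>\<^sup>2) \<partial>M)"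
    using IH b by simp
  also have "\<dots> \<le> exp ?q * (1 - ?q) * (\<integral>w. ?u w \<partial>M) + ?q * exp (?q - 1) * (exp 1 * (\<integral>w. ?u w \<partial>M))"
    using b by (intro add_left_mono mult_left_mono) auto
  also have "\<dots> = exp ?q * (1 - ?q) * (\<integral>w. ?u w \<partial>M) + ?q * (exp (?q - 1) * exp 1) * (\<integral>w. ?u w \<partial>M)"
    by (simp only: mult.assoc)
  also have "\<dots> = exp ?q * (\<integral>w. ?u w \<partial>M)"
    unfolding exp_add[symmetric] diff_add_cancel by (simp only: algebra_simps)
  also have "\<dots> \<le> exp ?q * exp (real k * ?q)" using IH by (intro mult_left_mono) auto
  also have "\<dots> = exp (real (Suc k) * ?q)" unfolding exp_add[symmetric] by (simp only: of_nat_Suc distrib_right mult_1)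
  finally show ?case unfolding S using int by simp
qed (simp add: prob_space)

text \<open>The squares of the earlier noise terms form an adapted weight, so every further term
  costs one factor \<open>exp 1\<close>.\<close>

lemma exp_sum_squares:
  assumes "k \<le> n"
  shows "integrable M (\<lambda>w. exp (\<Sum>j\<in>{1..k}. (norm (\<delta> j w))\<^sup>2 / \<sigma>\<^sup>2)) \<and>
    (\<integral>w. exp (\<Sum>j\<in>{1..k}. (norm (\<delta> j w))\<^sup>2 / \<sigma>\<^sup>2) \<partial>M) \<le> exp (real k)"
  using assms
proof (induction k)
  case (Suc k)
  let ?u = "\<lambda>w. exp (\<Sum>j\<in>{1..k}. (norm (\<delta> j w))\<^sup>2 / \<sigma>\<^sup>2)"
  have k: "Suc k \<in> {1..n}" "k \<le> n" using Suc by auto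
  note IH = Suc.IH[OF k(2)]
  have "?u \<in> borel_measurable (F (Suc k))"
  proof (intro measurable_compose[OF _ borel_measurable_exp] borel_measurable_sum)
    fix j assume "j \<in> {1..k}"
    then have [measurable]: "\<delta> j \<in> borel_measurable (F (Suc k))" using adapted[OF k(1)] by simp
    show "(\<lambda>w. (norm (\<delta> j w))\<^sup>2 / \<sigma>\<^sup>2) \<in> borel_measurable (F (Suc k))" by measurable
  qed
  with IH k have int: "integrable M (\<lambda>w. ?u w * exp ((norm (\<delta> (Suc k) w))\<^sup>2 / \<sigma>\<^sup>2))"
    and "(\<integral>w. ?u w * exp ((norm (\<delta> (Suc k) w))\<^sup>2 / \<sigma>\<^sup>2) \<partial>M) \<le> exp 1 * (\<integral>w. ?u w \<partial>M)"
    using exp_square_integrable[of "Suc k" ?u] exp_square_bound[of "Suc k" ?u] by auto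
  note this(2)
  also have "exp 1 * (\<integral>w. ?u w \<partial>M) \<le> exp (real (Suc k))"
    unfolding of_nat_Suc exp_add using IH by (intro mult_left_mono) auto
  finally have "(\<integral>w. ?u w * exp ((norm (\<delta> (Suc k) w))\<^sup>2 / \<sigma>\<^sup>2) \<partial>M) \<le> exp (real (Suc k))" .
  with int show ?case by (simp add: exp_add)
qed (simp add: prob_space)

theorem noise_tail:
  assumes n: "n \<ge> 1" and l: "l > 0"
  shows "prob {w\<in>space M. 2 * (1 + l)\<^sup>2 * real n * \<sigma>\<^sup>2 \<le> (norm (partial n w))\<^sup>2} \<le> exp (- (l\<^sup>2) / 3)"
proof -
  let ?r = "2 * (1 + l)\<^sup>2 * real n * \<sigma>\<^sup>2"
  let ?A = "{w\<in>space M. ?r \<le> (norm (partial n w))\<^sup>2}"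
  note [measurable] = partial_measurable[OF order_refl]
  have r: "?r > 0" using n l \<sigma>_pos by simp
  consider "l \<le> 1" | "l > 1" "(1 + l)\<^sup>2 \<le> 2 * real n" | "l > 1" "2 * real n < (1 + l)\<^sup>2" by linarith
  then show ?thesis
  proof cases
    case 1
    \<comment> \<open>For \<open>l \<le> 1\<close> the target is at least 2/3, while the second
      moment already gives at most 1/2.\<close>
    have "prob ?A \<le> (\<integral>w. (norm (partial n w))\<^sup>2 \<partial>M) / ?r"
      using partial_square[OF order_refl] r by (intro integral_Markov_inequality_measure[where A = "{}"]) auto
    also have "\<dots> \<le> real n * \<sigma>\<^sup>2 / ?r"
      using partial_square[OF order_refl] r by (intro divide_right_mono) auto
    also have "\<dots> = 1 / (2 * (1 + l)\<^sup>2)" using r n \<sigma>_pos by (simp add: field_simps)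
    also have "\<dots> \<le> 1 / 2" using l one_le_power[of "1 + l" 2] by (intro divide_left_mono) auto
    also have "\<dots> \<le> 1 + - (l\<^sup>2) / 3" using 1 l mult_mono[of l 1 l 1] by (simp add: power2_eq_square)
    also have "\<dots> \<le> exp (- (l\<^sup>2) / 3)" by (rule exp_ge_add_one_self)
    finally show ?thesis .
  next
    case 2
    \<comment> \<open>This \<open>c\<close> minimises the exponent
      \<open>n * (c * \<sigma>)\<^sup>2 - c * r\<close>, where r =
      \<open>sqrt (2 * n) * (1 + l) * \<sigma>\<close> is the threshold for the norm. The condition
      \<open>c * \<sigma> \<le> 1\<close> becomes precisely the bound on
      \<open>(1 + l)\<^sup>2\<close> that defines this case.\<close>
    define c where "c = (1 + l) / (sqrt (2 * real n) * \<sigma>)"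
    have c\<sigma>: "c * \<sigma> = (1 + l) / sqrt (2 * real n)" using \<sigma>_pos by (simp add: c_def)
    have c: "c > 0" "c * \<sigma> \<le> 1" using l n \<sigma>_pos 2 real_le_rsqrt[OF 2(2)] by (auto simp: c_def)
    have q: "real n * (c * \<sigma>)\<^sup>2 = (1 + l)\<^sup>2 / 2" using n c\<sigma> by (simp add: power_divide)
    have "prob ?A \<le> prob {w\<in>space M. exp ((1 + l)\<^sup>2) / 2 \<le> cosh (c * norm (partial n w))}"
    proof (rule finite_measure_mono)
      show "{w\<in>space M. exp ((1 + l)\<^sup>2) / 2 \<le> cosh (c * norm (partial n w))} \<in> sets M"
        using cosh_partial[OF c order_refl] by (intro borel_measurable_le) auto
      have "exp ((1 + l)\<^sup>2) / 2 \<le> cosh (c * norm (partial n w))" if "?r \<le> (norm (partial n w))\<^sup>2" for w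
      proof -
        have "((1 + l)\<^sup>2)\<^sup>2 = 2 * (1 + l)\<^sup>2 * (real n * (c * \<sigma>)\<^sup>2)"
          unfolding q by (simp add: power2_eq_square)
        also have "\<dots> = c\<^sup>2 * ?r" by (simp add: power_mult_distrib)
        also have "\<dots> \<le> c\<^sup>2 * (norm (partial n w))\<^sup>2"
          using that by (intro mult_left_mono) auto
        also have "\<dots> = (c * norm (partial n w))\<^sup>2" by (rule power_mult_distrib[symmetric])
        finally have "(1 + l)\<^sup>2 \<le> c * norm (partial n w)"
          by (rule power2_le_imp_le) (use c in auto)
        then have "exp ((1 + l)\<^sup>2) / 2 \<le> exp (c * norm (partial n w)) / 2" by simp
        also have "\<dots> \<le> cosh (c * norm (partial n w))" by (simp add: cosh_field_def)
        finally show ?thesis .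
      qed
      then show "?A \<subseteq> {w\<in>space M. exp ((1 + l)\<^sup>2) / 2 \<le> cosh (c * norm (partial n w))}" by auto
    qed
    also have "\<dots> \<le> (\<integral>w. cosh (c * norm (partial n w)) \<partial>M) / (exp ((1 + l)\<^sup>2) / 2)"
      using cosh_partial[OF c order_refl] by (intro integral_Markov_inequality_measure[where A = "{}"]) auto
    also have "\<dots> \<le> exp ((1 + l)\<^sup>2 / 2) / (exp ((1 + l)\<^sup>2) / 2)"
      using cosh_partial[OF c order_refl] q by (intro divide_right_mono) auto
    also have "\<dots> = 2 * exp ((1 + l)\<^sup>2 / 2 - (1 + l)\<^sup>2)" unfolding exp_diff by simp
    \<comment> \<open>The prefactor 2 is absorbed as 2 \<le> e. The exponent is then
      \<open>1/2 - l - l\<^sup>2 / 2\<close>, which lies below \<open>- (l\<^sup>2) / 3\<close>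
      because \<open>l > 1\<close>.\<close>
    also have "\<dots> \<le> exp 1 * exp ((1 + l)\<^sup>2 / 2 - (1 + l)\<^sup>2)"
      using exp_ge_add_one_self[of 1] by (intro mult_right_mono) auto
    also have "\<dots> = exp (1 + ((1 + l)\<^sup>2 / 2 - (1 + l)\<^sup>2))" by (rule exp_add[symmetric])
    also have "\<dots> \<le> exp (- (l\<^sup>2) / 3)"
    proof -
      have "(1 + l)\<^sup>2 = 1 + 2 * l + l\<^sup>2" by (simp add: power2_sum)
      then show ?thesis unfolding exp_le_cancel_iff using 2 zero_le_power2[of l] by linarith
    qed
    finally show ?thesis .
  next
    case 3
    let ?s = "\<lambda>w. \<Sum>j\<in>{1..n}. (norm (\<delta> j w))\<^sup>2 / \<sigma>\<^sup>2"
    have "prob ?A \<le> prob {w\<in>space M. exp (2 * (1 + l)\<^sup>2) \<le> exp (?s w)}"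
    proof (rule finite_measure_mono)
      show "{w\<in>space M. exp (2 * (1 + l)\<^sup>2) \<le> exp (?s w)} \<in> sets M"
        using exp_sum_squares[OF order_refl] by (intro borel_measurable_le) auto
      have "2 * (1 + l)\<^sup>2 \<le> ?s w" if "?r \<le> (norm (partial n w))\<^sup>2" for w
      proof -
        \<comment> \<open>Cauchy-Schwarz loses a factor \<open>n\<close> here. This is affordable
          because in this case \<open>n\<close> is less than half of \<open>(1 + l)\<^sup>2\<close>,
          so the final exponent is below -3/2 times \<open>(1 + l)\<^sup>2\<close>.\<close>
        have "(norm (partial n w))\<^sup>2 \<le> (\<Sum>j\<in>{1..n}. norm (\<delta> j w))\<^sup>2"
          by (intro power_mono norm_sum) auto
        also have "\<dots> \<le> (\<Sum>j\<in>{1..n}. 1\<^sup>2) * (\<Sum>j\<in>{1..n}. (norm (\<delta> j w))\<^sup>2)"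
          using Cauchy_Schwarz_ineq_sum[of "\<lambda>_. 1" "\<lambda>j. norm (\<delta> j w)" "{1..n}"] by simp
        finally have "2 * (1 + l)\<^sup>2 * \<sigma>\<^sup>2 * real n \<le> (\<Sum>j\<in>{1..n}. (norm (\<delta> j w))\<^sup>2) * real n"
          using that by (simp add: mult_ac)
        then have "2 * (1 + l)\<^sup>2 * \<sigma>\<^sup>2 \<le> (\<Sum>j\<in>{1..n}. (norm (\<delta> j w))\<^sup>2)"
          using n by (simp add: mult_le_cancel_right)
        then show ?thesis using \<sigma>_pos by (simp add: field_simps flip: sum_divide_distrib)
      qed
      then show "?A \<subseteq> {w\<in>space M. exp (2 * (1 + l)\<^sup>2) \<le> exp (?s w)}" by auto
    qed
    also have "\<dots> \<le> (\<integral>w. exp (?s w) \<partial>M) / exp (2 * (1 + l)\<^sup>2)"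
      using exp_sum_squares[OF order_refl] by (intro integral_Markov_inequality_measure[where A = "{}"]) auto
    also have "\<dots> \<le> exp (real n) / exp (2 * (1 + l)\<^sup>2)"
      using exp_sum_squares[OF order_refl] by (intro divide_right_mono) auto
    also have "\<dots> = exp (real n - 2 * (1 + l)\<^sup>2)" unfolding exp_diff by simp
    also have "\<dots> \<le> exp (- (l\<^sup>2) / 3)" using 3 l by (simp add: power2_eq_square field_simps)
    finally show ?thesis .
  qed
qed

end

section \<open>The prox-mapping\<close>

text \<open>As \<open>X\<close> may have empty interior, smoothness is only used along segments
  between points of \<open>X\<close>. Convexity keeps them inside \<open>X\<close>, and the
  derivative within \<open>X\<close> restricts to them.\<close>

lemma C1_on_segment_derivative:
  fixes F :: "'a::euclidean_space \<Rightarrow> real"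
  assumes "C1_on X F dF" "convex X" "x \<in> X" "y \<in> X" "t \<in> {0..1}"
  shows "((\<lambda>t. F (x + t *\<^sub>R (y - x))) has_real_derivative dF (x + t *\<^sub>R (y - x)) \<bullet> (y - x))
           (at t within {0..1})"
proof -
  let ?l = "\<lambda>t::real. x + t *\<^sub>R (y - x)"
  have sub: "?l ` {0..1} \<subseteq> X"
  proof
    fix z assume "z \<in> ?l ` {0..1}"
    then obtain s where s: "s \<in> {0..1}" "z = ?l s" by auto
    then have "z = (1 - s) *\<^sub>R x + s *\<^sub>R y" by (simp add: algebra_simps)
    then show "z \<in> X" using assms s by (simp add: convex_alt)
  qed
  have "(F has_derivative (\<lambda>v. dF (?l t) \<bullet> v)) (at (?l t) within X)"
    using assms sub unfolding C1_on_def by blast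
  then have F: "(F has_derivative (\<lambda>v. dF (?l t) \<bullet> v)) (at (?l t) within ?l ` {0..1})"
    using has_derivative_subset sub by blast
  have "(?l has_derivative (\<lambda>s. s *\<^sub>R (y - x))) (at t within {0..1})"
    by (auto intro!: derivative_eq_intros)
  from has_derivative_in_compose[OF this F]
  show ?thesis unfolding has_field_derivative_def by (simp add: mult_commute_abs)
qed

text \<open>Instead of integrating the gradient along the segment, the mean value theorem is applied
  to \<open>\<phi>\<close>, the difference of \<open>f\<close> and the terms of its quadratic
  majorant that depend on \<open>t\<close>. The Lipschitz condition makes the derivative of
  \<open>\<phi>\<close> nonpositive.\<close>

lemma (in composite_problem) descent_lemma:
  assumes "x \<in> X" "y \<in> X"
  shows "f y \<le> f x + gradf x \<bullet> (y - x) + L / 2 * (norm (y - x))\<^sup>2"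
proof -
  define d where "d = y - x"
  define \<phi> where "\<phi> t = f (x + t *\<^sub>R d) - t * (gradf x \<bullet> d) - L / 2 * t\<^sup>2 * (norm d)\<^sup>2" for t
  have "(\<phi> has_real_derivative
      (gradf (x + t *\<^sub>R d) \<bullet> d - gradf x \<bullet> d - L * t * (norm d)\<^sup>2)) (at t within {0..1})"
    if "t \<in> {0..1}" for t
    unfolding \<phi>_def using C1_on_segment_derivative[OF f_C1 X_convex assms that, folded d_def]
    by (auto intro!: derivative_eq_intros)
  then have "\<exists>t\<in>{0<..<1}. \<phi> 1 - \<phi> 0
      = (\<lambda>s. (gradf (x + t *\<^sub>R d) \<bullet> d - gradf x \<bullet> d - L * t * (norm d)\<^sup>2) * s) (1 - 0)"
    by (intro mvt_simple[of 0 1 \<phi>]) (auto simp: has_field_derivative_def)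
  then obtain t where t: "0 < t" "t < 1"
    "\<phi> 1 - \<phi> 0 = gradf (x + t *\<^sub>R d) \<bullet> d - gradf x \<bullet> d - L * t * (norm d)\<^sup>2" by auto
  have "x + t *\<^sub>R d = (1 - t) *\<^sub>R x + t *\<^sub>R y" by (simp add: algebra_simps d_def)
  then have X: "x + t *\<^sub>R d \<in> X" using assms t X_convex by (simp add: convex_alt)
  have "(gradf (x + t *\<^sub>R d) - gradf x) \<bullet> d \<le> norm (gradf (x + t *\<^sub>R d) - gradf x) * norm d"
    by (rule norm_cauchy_schwarz)
  also have "\<dots> \<le> L * norm (t *\<^sub>R d) * norm d"
    using gradf_lipschitz[OF assms(1) X] by (intro mult_right_mono) auto
  also have "\<dots> = L * t * (norm d)\<^sup>2" using t by (simp add: power2_eq_square)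
  finally have "\<phi> 1 \<le> \<phi> 0" using t by (simp add: inner_diff_left)
  then show ?thesis by (simp add: \<phi>_def d_def)
qed

context prox_setting
begin

abbreviation "prox \<equiv> prox_map X h \<omega> grad\<omega>"
abbreviation "pgrad \<equiv> gen_proj_grad X h \<omega> grad\<omega>"

lemma prox_arg_min:
  assumes "x \<in> X" "\<gamma> > 0"
  shows "is_arg_min (prox_objective h \<omega> grad\<omega> x g \<gamma>) (\<lambda>u. u \<in> X) (prox x g \<gamma>)"
  unfolding prox_map_def arg_min_on_def arg_min_def using prox_solvable[OF assms] by (rule someI_ex)

lemma prox_in: "x \<in> X \<Longrightarrow> \<gamma> > 0 \<Longrightarrow> prox x g \<gamma> \<in> X"
  using prox_arg_min[of x \<gamma> g] by (auto simp: is_arg_min_def)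

text \<open>Only the smooth part of the objective is differentiated. Minimality of \<open>p\<close>
  and convexity of \<open>h\<close> on the segment towards \<open>u\<close> bound its difference
  quotients from below by \<open>h p - h u\<close>, and the bound survives the limit at 0.\<close>

lemma prox_variational:
  fixes g :: 'a
  assumes x: "x \<in> X" and \<gamma>: "\<gamma> > 0" and u: "u \<in> X"
  defines "p \<equiv> prox x g \<gamma>"
  shows "h p - h u \<le> (g + (1 / \<gamma>) *\<^sub>R (grad\<omega> p - grad\<omega> x)) \<bullet> (u - p)"
proof -
  define d where "d = u - p"
  define \<phi> where "\<phi> t = g \<bullet> (p + t *\<^sub>R d) + 1 / \<gamma> * bregman \<omega> grad\<omega> (p + t *\<^sub>R d) x" for t
  have p: "p \<in> X" unfolding p_def using x \<gamma> by (rule prox_in)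
  have "(\<phi> has_real_derivative (g + (1 / \<gamma>) *\<^sub>R (grad\<omega> p - grad\<omega> x)) \<bullet> d) (at 0 within {0..1})"
    unfolding \<phi>_def bregman_def
    using C1_on_segment_derivative[OF \<omega>_C1 X_convex p u, of 0, folded d_def] \<gamma>
    by (auto intro!: derivative_eq_intros simp: algebra_simps inner_diff_left inner_diff_right divide_simps)
  then have lim: "((\<lambda>t. (\<phi> t - \<phi> 0) / t) \<longlongrightarrow> (g + (1 / \<gamma>) *\<^sub>R (grad\<omega> p - grad\<omega> x)) \<bullet> d) (at 0 within {0..1})"
    by (simp add: has_field_derivative_iff)
  have "\<forall>\<^sub>F t in at 0 within {0..1}. h p - h u \<le> (\<phi> t - \<phi> 0) / t"
    unfolding eventually_at_filter
  proof (rule always_eventually, intro allI impI)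
    fix t :: real assume t: "t \<noteq> 0" "t \<in> {0..1}"
    have e: "p + t *\<^sub>R d = (1 - t) *\<^sub>R p + t *\<^sub>R u" by (simp add: algebra_simps d_def)
    then have X: "p + t *\<^sub>R d \<in> X" using p u t X_convex by (simp add: convex_alt)
    have "\<phi> 0 + h p \<le> \<phi> t + h (p + t *\<^sub>R d)"
      using prox_arg_min[OF x \<gamma>, of g] X
      by (auto simp: is_arg_min_def p_def[symmetric] prox_objective_def \<phi>_def not_less)
    also have "h (p + t *\<^sub>R d) \<le> (1 - t) * h p + t * h u"
      unfolding e using h_convex p u t by (intro convex_onD) auto
    finally have "t * (h p - h u) \<le> \<phi> t - \<phi> 0" by (simp add: algebra_simps)
    then show "h p - h u \<le> (\<phi> t - \<phi> 0) / t" using t by (simp add: field_simps)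
  qed
  with lim have "h p - h u \<le> (g + (1 / \<gamma>) *\<^sub>R (grad\<omega> p - grad\<omega> x)) \<bullet> d"
    by (rule tendsto_lowerbound) (simp add: trivial_limit_within islimpt_Icc)
  then show ?thesis by (simp add: d_def)
qed

text \<open>The variational inequality tested at \<open>u = x\<close>; strong monotonicity of
  \<open>grad\<omega>\<close> supplies the quadratic term.\<close>

lemma pgrad_inner:
  assumes x: "x \<in> X" and \<gamma>: "\<gamma> > 0"
  shows "\<alpha> * (norm (pgrad x g \<gamma>))\<^sup>2 + (h (prox x g \<gamma>) - h x) / \<gamma> \<le> g \<bullet> pgrad x g \<gamma>"
proof -
  define p where "p = prox x g \<gamma>"
  have p: "p \<in> X" unfolding p_def using x \<gamma> by (rule prox_in)
  have P: "pgrad x g \<gamma> = (1 / \<gamma>) *\<^sub>R (x - p)" by (simp add: gen_proj_grad_def p_def)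
  have "h p - h x \<le> g \<bullet> (x - p) - 1 / \<gamma> * ((x - p) \<bullet> (grad\<omega> x - grad\<omega> p))"
    using prox_variational[OF x \<gamma> x, of g, folded p_def]
    by (simp add: inner_add_left inner_diff_left inner_diff_right inner_commute algebra_simps)
  also have "\<dots> \<le> g \<bullet> (x - p) - 1 / \<gamma> * (\<alpha> * (norm (x - p))\<^sup>2)"
    using \<omega>_strong[OF x p] \<gamma> by (intro diff_left_mono mult_left_mono) auto
  finally have "(h p - h x) / \<gamma> \<le> (g \<bullet> (x - p) - 1 / \<gamma> * (\<alpha> * (norm (x - p))\<^sup>2)) / \<gamma>"
    using \<gamma> by (intro divide_right_mono) auto
  also have "\<dots> = g \<bullet> (x - p) / \<gamma> - \<alpha> * (norm (x - p) / \<gamma>)\<^sup>2"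
    using \<gamma> by (simp add: power2_eq_square field_simps)
  moreover have N: "norm (pgrad x g \<gamma>) = norm (x - p) / \<gamma>" "g \<bullet> pgrad x g \<gamma> = g \<bullet> (x - p) / \<gamma>"
    using \<gamma> unfolding P by simp_all
  ultimately show ?thesis unfolding p_def[symmetric] N by simp
qed

text \<open>Adding the variational inequalities of the two prox-points, each tested at the other
  one, cancels \<open>h\<close>. The base points enter only through \<open>grad\<omega>\<close>, so
  the estimate gives Lipschitz dependence on the direction as well as joint continuity.\<close>

lemma prox_lipschitz:
  assumes x: "x \<in> X" and y: "y \<in> X" and \<gamma>: "\<gamma> > 0"
  shows "norm (prox x g \<gamma> - prox y g' \<gamma>)
    \<le> (norm (grad\<omega> x - grad\<omega> y) + \<gamma> * norm (g - g')) / \<alpha>"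
proof -
  define p where "p = prox x g \<gamma>"
  define q where "q = prox y g' \<gamma>"
  define e where "e = (grad\<omega> x - grad\<omega> y) - \<gamma> *\<^sub>R (g - g')"
  have p: "p \<in> X" "q \<in> X" unfolding p_def q_def using x y \<gamma> by (auto intro: prox_in)
  have "0 \<le> (g + (1 / \<gamma>) *\<^sub>R (grad\<omega> p - grad\<omega> x)) \<bullet> (q - p)
      + (g' + (1 / \<gamma>) *\<^sub>R (grad\<omega> q - grad\<omega> y)) \<bullet> (p - q)"
    using prox_variational[OF x \<gamma> p(2), of g, folded p_def]
      prox_variational[OF y \<gamma> p(1), of g', folded q_def] by simp
  also have "\<dots> = (e \<bullet> (p - q) - (p - q) \<bullet> (grad\<omega> p - grad\<omega> q)) / \<gamma>"
    using \<gamma> by (simp add: e_def inner_simps inner_commute add_divide_distrib diff_divide_distrib)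
  finally have "(p - q) \<bullet> (grad\<omega> p - grad\<omega> q) \<le> e \<bullet> (p - q)" using \<gamma> by (simp add: zero_le_divide_iff)
  then have "\<alpha> * (norm (p - q))\<^sup>2 \<le> e \<bullet> (p - q)" using \<omega>_strong[OF p] by simp
  also have "\<dots> \<le> norm e * norm (p - q)" by (rule norm_cauchy_schwarz)
  finally have "norm (p - q) * (\<alpha> * norm (p - q)) \<le> norm (p - q) * norm e"
    by (simp add: power2_eq_square mult_ac)
  then have "\<alpha> * norm (p - q) \<le> norm e"
    by (cases "p = q") (auto simp: mult_le_cancel_left)
  also have "\<dots> \<le> norm (grad\<omega> x - grad\<omega> y) + \<gamma> * norm (g - g')"
    unfolding e_def using norm_triangle_ineq4[of "grad\<omega> x - grad\<omega> y" "\<gamma> *\<^sub>R (g - g')"] \<gamma> by simp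
  finally show ?thesis using \<alpha>_pos by (simp add: p_def q_def field_simps)
qed

lemma pgrad_lipschitz:
  assumes "x \<in> X" "\<gamma> > 0"
  shows "norm (pgrad x g \<gamma> - pgrad x g' \<gamma>) \<le> norm (g - g') / \<alpha>"
proof -
  have "pgrad x g \<gamma> - pgrad x g' \<gamma> = (1 / \<gamma>) *\<^sub>R (prox x g' \<gamma> - prox x g \<gamma>)"
    by (simp add: gen_proj_grad_def flip: scaleR_diff_right)
  then have N: "norm (pgrad x g \<gamma> - pgrad x g' \<gamma>) = norm (prox x g' \<gamma> - prox x g \<gamma>) / \<gamma>"
    using assms by simp
  show ?thesis unfolding N
    using prox_lipschitz[OF assms(1,1,2), of g' g] assms \<alpha>_pos by (simp add: norm_minus_commute field_simps)
qed

text \<open>Joint continuity is what makes the random iterates, and the exact projected gradients at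
  them, Borel measurable.\<close>

lemma continuous_on_prox:
  assumes \<gamma>: "\<gamma> > 0"
  shows "continuous_on (X \<times> UNIV) (\<lambda>(x, g). prox x g \<gamma>)"
  unfolding continuous_on_def
proof
  fix z :: "'a \<times> 'a" assume z: "z \<in> X \<times> UNIV"
  have "continuous_on (X \<times> UNIV)
      (\<lambda>v. (norm (grad\<omega> (fst v) - grad\<omega> (fst z)) + \<gamma> * norm (snd v - snd z)) / \<alpha>)"
    using \<omega>_C1 \<alpha>_pos unfolding C1_on_def
    by (intro continuous_intros) (auto intro!: continuous_on_compose2[of X grad\<omega>] continuous_intros)
  with z have "((\<lambda>v. (norm (grad\<omega> (fst v) - grad\<omega> (fst z)) + \<gamma> * norm (snd v - snd z)) / \<alpha>) \<longlongrightarrow>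
      (norm (grad\<omega> (fst z) - grad\<omega> (fst z)) + \<gamma> * norm (snd z - snd z)) / \<alpha>) (at z within X \<times> UNIV)"
    unfolding continuous_on_def by blast
  then have lim: "((\<lambda>v. (norm (grad\<omega> (fst v) - grad\<omega> (fst z)) + \<gamma> * norm (snd v - snd z)) / \<alpha>) \<longlongrightarrow> 0)
      (at z within X \<times> UNIV)" by simp
  have "((\<lambda>v. (case v of (x, g) \<Rightarrow> prox x g \<gamma>) - (case z of (x, g) \<Rightarrow> prox x g \<gamma>)) \<longlongrightarrow> 0)
      (at z within X \<times> UNIV)"
    by (rule Lim_null_comparison[OF _ lim])
      (use z \<gamma> in \<open>auto simp: eventually_at_filter intro!: always_eventually prox_lipschitz\<close>)
  then show "((\<lambda>v. case v of (x, g) \<Rightarrow> prox x g \<gamma>) \<longlongrightarrow> (case z of (x, g) \<Rightarrow> prox x g \<gamma>))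
      (at z within X \<times> UNIV)"
    by (simp add: LIM_zero_iff)
qed

lemma continuous_on_pgrad_gradf:
  assumes "\<gamma> > 0"
  shows "continuous_on X (\<lambda>x. pgrad x (gradf x) \<gamma>)"
proof -
  have "continuous_on X (\<lambda>x. (\<lambda>(x, g). prox x g \<gamma>) (x, gradf x))"
    using f_C1 unfolding C1_on_def
    by (intro continuous_on_compose2[OF continuous_on_prox[OF assms]]) (auto intro!: continuous_intros)
  then show ?thesis unfolding gen_proj_grad_def by (auto intro!: continuous_intros)
qed

text \<open>The descent lemma produces an inner product of the error \<delta> with \<open>P\<close>,
  which itself depends on \<delta>. Replacing \<open>P\<close> by the exact \<open>Q\<close> leaves
  a term that a centred error makes vanish in expectation. The price is \<open>1 / (2 * L)\<close>
  for the difference \<open>P - Q\<close> and \<open>1 / (4 * L)\<close> for passing from the norm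
  of \<open>P\<close> to that of \<open>Q\<close>, together \<open>3 / (4 * L)\<close>.\<close>

lemma prox_step_decrease:
  assumes x: "x \<in> X"
  defines "\<gamma> \<equiv> \<alpha> / (2 * L)"
  shows "f (prox x g \<gamma>) + h (prox x g \<gamma>) + \<alpha>\<^sup>2 / (8 * L) * (norm (pgrad x (gradf x) \<gamma>))\<^sup>2
    \<le> f x + h x + \<gamma> * ((g - gradf x) \<bullet> pgrad x (gradf x) \<gamma>)
      + 3 / (4 * L) * (norm (g - gradf x))\<^sup>2"
proof -
  define p where "p = prox x g \<gamma>"
  define P where "P = pgrad x g \<gamma>"
  define Q where "Q = pgrad x (gradf x) \<gamma>"
  define \<delta> where "\<delta> = g - gradf x"
  have \<gamma>: "\<gamma> > 0" using \<alpha>_pos L_pos by (simp add: \<gamma>_def)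
  have p: "p \<in> X" unfolding p_def using x \<gamma> by (rule prox_in)
  have px: "p - x = - (\<gamma> *\<^sub>R P)" using \<gamma> by (simp add: P_def p_def gen_proj_grad_def)
  have PQ: "norm (P - Q) \<le> norm \<delta> / \<alpha>" unfolding P_def Q_def \<delta>_def using x \<gamma> by (rule pgrad_lipschitz)
  have "f p \<le> f x - \<gamma> * (gradf x \<bullet> P) + L / 2 * \<gamma>\<^sup>2 * (norm P)\<^sup>2"
    using descent_lemma[OF x p] \<gamma> unfolding px by (simp add: power_mult_distrib)
  also have "gradf x \<bullet> P = g \<bullet> P - \<delta> \<bullet> Q - \<delta> \<bullet> (P - Q)"
    by (simp add: \<delta>_def algebra_simps inner_diff_left inner_diff_right)
  finally have 1: "f p \<le> f x - \<gamma> * (g \<bullet> P) + \<gamma> * (\<delta> \<bullet> Q) + \<gamma> * (\<delta> \<bullet> (P - Q)) + L / 2 * \<gamma>\<^sup>2 * (norm P)\<^sup>2"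
    by (simp add: algebra_simps)
  have "\<delta> \<bullet> (P - Q) \<le> norm \<delta> * (norm \<delta> / \<alpha>)"
    using norm_cauchy_schwarz[of \<delta> "P - Q"] mult_left_mono[OF PQ, of "norm \<delta>"] by simp
  then have 2: "\<gamma> * (\<delta> \<bullet> (P - Q)) \<le> 1 / (2 * L) * (norm \<delta>)\<^sup>2"
    using \<gamma> mult_left_mono[of "\<delta> \<bullet> (P - Q)" "norm \<delta> * (norm \<delta> / \<alpha>)" \<gamma>] \<alpha>_pos L_pos
    by (simp add: \<gamma>_def power2_eq_square field_simps)
  have "\<alpha> * (norm P)\<^sup>2 + (h p - h x) / \<gamma> \<le> g \<bullet> P"
    unfolding P_def p_def using x \<gamma> by (rule pgrad_inner)
  then have 3: "\<gamma> * \<alpha> * (norm P)\<^sup>2 + (h p - h x) \<le> \<gamma> * (g \<bullet> P)"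
    using \<gamma> mult_left_mono[of "\<alpha> * (norm P)\<^sup>2 + (h p - h x) / \<gamma>" "g \<bullet> P" \<gamma>] by (simp add: field_simps)
  \<comment> \<open>The left side equals \<open>3 * \<alpha>\<^sup>2 / (8 * L)\<close>. The weaker
    bound is twice the coefficient of the squared norm of \<open>Q\<close> in the claim, which is
    what the comparison of \<open>P\<close> and \<open>Q\<close> costs.\<close>
  have 4: "\<gamma> * \<alpha> - L / 2 * \<gamma>\<^sup>2 \<ge> \<alpha>\<^sup>2 / (4 * L)"
    using L_pos by (simp add: \<gamma>_def power2_eq_square field_simps)
  have "(norm Q)\<^sup>2 \<le> (norm P + norm (P - Q))\<^sup>2"
    by (intro power_mono) (use norm_triangle_ineq4[of P "P - Q"] in auto)
  also have "\<dots> \<le> 2 * (norm P)\<^sup>2 + 2 * (norm (P - Q))\<^sup>2"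
    using sum_squares_bound[of "norm P" "norm (P - Q)"] by (simp add: power2_sum)
  also have "(norm (P - Q))\<^sup>2 \<le> (norm \<delta> / \<alpha>)\<^sup>2" using PQ by (intro power_mono) auto
  finally have "\<alpha>\<^sup>2 / (8 * L) * (norm Q)\<^sup>2 \<le> \<alpha>\<^sup>2 / (8 * L) * (2 * (norm P)\<^sup>2 + 2 * (norm \<delta> / \<alpha>)\<^sup>2)"
    using L_pos by (intro mult_left_mono) auto
  also have "\<dots> = \<alpha>\<^sup>2 / (4 * L) * (norm P)\<^sup>2 + 1 / (4 * L) * (norm \<delta>)\<^sup>2"
    using \<alpha>_pos L_pos by (simp add: power_divide field_simps)
  finally have 5: "\<alpha>\<^sup>2 / (8 * L) * (norm Q)\<^sup>2
      \<le> (\<gamma> * \<alpha> - L / 2 * \<gamma>\<^sup>2) * (norm P)\<^sup>2 + 1 / (4 * L) * (norm \<delta>)\<^sup>2"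
    using mult_right_mono[OF 4, of "(norm P)\<^sup>2"] by simp
  have "3 / (4 * L) * (norm \<delta>)\<^sup>2 = 1 / (2 * L) * (norm \<delta>)\<^sup>2 + 1 / (4 * L) * (norm \<delta>)\<^sup>2"
    using L_pos by (simp add: field_simps)
  then show ?thesis using 1 2 3 5
    unfolding p_def[symmetric] Q_def[symmetric] \<delta>_def[symmetric] by (simp add: left_diff_distrib)
qed

text \<open>The last iterate is followed by an imaginary step along the exact gradient, as no oracle call
  is made there.\<close>

lemma rspg_sum_bound:
  fixes x :: "nat \<Rightarrow> 'a"
  defines "\<gamma> \<equiv> \<alpha> / (2 * L)"
  assumes x1: "x 1 \<in> X" and step: "\<And>k. k \<ge> 1 \<Longrightarrow> x (Suc k) = prox (x k) (g k) \<gamma>" and n: "n \<ge> 1"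
  shows "(\<Sum>k\<in>{1..n}. \<alpha>\<^sup>2 / (8 * L) * (norm (pgrad (x k) (gradf (x k)) \<gamma>))\<^sup>2)
    \<le> f (x 1) + h (x 1) - opt_value X f h
      + (\<Sum>k\<in>{1..<n}. \<gamma> * ((g k - gradf (x k)) \<bullet> pgrad (x k) (gradf (x k)) \<gamma>)
           + 3 / (4 * L) * (norm (g k - gradf (x k)))\<^sup>2)"
proof -
  have \<gamma>: "\<gamma> > 0" using \<alpha>_pos L_pos by (simp add: \<gamma>_def)
  define A where "A k = \<alpha>\<^sup>2 / (8 * L) * (norm (pgrad (x k) (gradf (x k)) \<gamma>))\<^sup>2" for k
  define B where "B k = \<gamma> * ((g k - gradf (x k)) \<bullet> pgrad (x k) (gradf (x k)) \<gamma>)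
           + 3 / (4 * L) * (norm (g k - gradf (x k)))\<^sup>2" for k
  have X: "x (Suc k) \<in> X" for k
    by (induction k) (use x1 step \<gamma> prox_in in auto)
  have tele: "f (x (Suc k)) + h (x (Suc k)) + (\<Sum>j\<in>{1..k}. A j) \<le> f (x 1) + h (x 1) + (\<Sum>j\<in>{1..k}. B j)" for k
  proof (induction k)
    case (Suc k)
    show ?case
      using Suc prox_step_decrease[OF X[of k], of "g (Suc k)"] step[of "Suc k"]
      by (simp add: A_def B_def \<gamma>_def)
  qed simp
  obtain k where k: "n = Suc k" using n by (cases n) auto
  let ?p = "prox (x n) (gradf (x n)) \<gamma>"
  have "opt_value X f h \<le> f ?p + h ?p"
    unfolding opt_value_def using opt_value_finite prox_in[OF X[of k] \<gamma>] k by (intro cINF_lower) auto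
  moreover have "f ?p + h ?p + A n \<le> f (x n) + h (x n)"
    using prox_step_decrease[OF X[of k], of "gradf (x n)"] k by (simp add: A_def \<gamma>_def)
  ultimately show ?thesis using tele[of k] k
    unfolding A_def[symmetric] B_def[symmetric] by (simp add: atLeastLessThanSuc_atLeastAtMost)
qed

end

section \<open>From the oracle assumptions to integral inequalities\<close>

text \<open>Computing with nonnegative extended integrals first yields a finite bound, and
  integrability of the product is then a consequence.\<close>

lemma (in sigma_finite_subalgebra) integral_le_of_nn_cond_exp_le:
  fixes g u :: "'a \<Rightarrow> real"
  assumes [measurable]: "g \<in> borel_measurable M" and g: "\<And>w. 0 \<le> g w"
    and c: "AE w in M. nn_cond_exp M F (\<lambda>w. ennreal (g w)) w \<le> ennreal c" "c \<ge> 0"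
    and u: "u \<in> borel_measurable F" "\<And>w. 0 \<le> u w" "integrable M u"
  shows "integrable M (\<lambda>w. u w * g w)" "(\<integral>w. u w * g w \<partial>M) \<le> c * (\<integral>w. u w \<partial>M)"
proof -
  note [measurable] = u(1) measurable_from_subalg[OF subalg u(1)]
  have "(\<integral>\<^sup>+w. ennreal (u w * g w) \<partial>M) = (\<integral>\<^sup>+w. ennreal (u w) * ennreal (g w) \<partial>M)"
    using u g by (simp add: ennreal_mult)
  also have "\<dots> = (\<integral>\<^sup>+w. ennreal (u w) * nn_cond_exp M F (\<lambda>w. ennreal (g w)) w \<partial>M)"
    by (rule nn_cond_exp_intg[symmetric]) measurable
  also have "\<dots> \<le> (\<integral>\<^sup>+w. ennreal (u w) * ennreal c \<partial>M)"
  proof (rule nn_integral_mono_AE)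
    show "AE w in M. ennreal (u w) * nn_cond_exp M F (\<lambda>w. ennreal (g w)) w \<le> ennreal (u w) * ennreal c"
      using c(1) by eventually_elim (rule mult_left_mono, auto)
  qed
  also have "\<dots> = (\<integral>\<^sup>+w. ennreal (c * u w) \<partial>M)"
    using u c(2) by (simp add: ennreal_mult mult.commute)
  also have "\<dots> = ennreal (c * (\<integral>w. u w \<partial>M))"
    using u c(2) by (subst nn_integral_eq_integral) auto
  finally have le: "(\<integral>\<^sup>+w. ennreal (u w * g w) \<partial>M) \<le> ennreal (c * (\<integral>w. u w \<partial>M))" .
  show int: "integrable M (\<lambda>w. u w * g w)"
    using u(2) g le_less_trans[OF le ennreal_less_top] by (intro integrableI_nonneg) auto
  have "ennreal (\<integral>w. u w * g w \<partial>M) \<le> ennreal (c * (\<integral>w. u w \<partial>M))"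
    using le u g by (subst (asm) nn_integral_eq_integral[OF int]) auto
  moreover have "0 \<le> c * (\<integral>w. u w \<partial>M)" using c(2) u by (intro mult_nonneg_nonneg integral_nonneg) auto
  ultimately show "(\<integral>w. u w * g w \<partial>M) \<le> c * (\<integral>w. u w \<partial>M)" by (simp add: ennreal_le_iff)
qed

context
  fixes M F :: "'w measure" and gradf :: "'a::euclidean_space \<Rightarrow> 'a" and \<sigma> :: real and x Y :: "'w \<Rightarrow> 'a"
  assumes prob: "prob_space M" and sub: "subalgebra M F"
    and Y_meas: "Y \<in> borel_measurable M" and grad_meas: "(\<lambda>w. gradf (x w)) \<in> borel_measurable F"
begin

interpretation prob_space M by (rule prob)

interpretation finite_measure_subalgebra M F by unfold_locales (rule sub)

lemma grad_meas_M: "(\<lambda>w. gradf (x w)) \<in> borel_measurable M"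
  by (rule measurable_from_subalg[OF sub grad_meas])

lemma oracle_A1_square:
  assumes "oracle_A1 M F gradf \<sigma> x Y"
  shows "integrable M (\<lambda>w. (norm (Y w - gradf (x w)))\<^sup>2)"
    "(\<integral>w. (norm (Y w - gradf (x w)))\<^sup>2 \<partial>M) \<le> \<sigma>\<^sup>2"
proof -
  note [measurable] = Y_meas grad_meas_M
  have AE: "AE w in M. nn_cond_exp M F (\<lambda>v. ennreal ((norm (Y v - gradf (x v)))\<^sup>2)) w \<le> ennreal (\<sigma>\<^sup>2)"
    using assms by (simp add: oracle_A1_def)
  have m: "(\<lambda>w. (norm (Y w - gradf (x w)))\<^sup>2) \<in> borel_measurable M" by measurable
  have one: "integrable M (\<lambda>_. 1 :: real)" "(\<lambda>_. 1 :: real) \<in> borel_measurable F" by auto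
  note * = integral_le_of_nn_cond_exp_le[OF m zero_le_power2 AE zero_le_power2 one(2) zero_le_one one(1)]
  show "integrable M (\<lambda>w. (norm (Y w - gradf (x w)))\<^sup>2)"
    using *(1) unfolding mult_1 .
  show "(\<integral>w. (norm (Y w - gradf (x w)))\<^sup>2 \<partial>M) \<le> \<sigma>\<^sup>2"
    using *(2) by (simp add: prob_space)
qed

lemma oracle_A2_exp:
  assumes "oracle_A2 M F gradf \<sigma> x Y" "u \<in> borel_measurable F" "\<And>w. 0 \<le> u w" "integrable M u"
  shows "integrable M (\<lambda>w. u w * exp ((norm (Y w - gradf (x w)))\<^sup>2 / \<sigma>\<^sup>2))"
    "(\<integral>w. u w * exp ((norm (Y w - gradf (x w)))\<^sup>2 / \<sigma>\<^sup>2) \<partial>M) \<le> exp 1 * (\<integral>w. u w \<partial>M)"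
proof -
  note [measurable] = Y_meas grad_meas_M
  have AE: "AE w in M. nn_cond_exp M F (\<lambda>v. ennreal (exp ((norm (Y v - gradf (x v)))\<^sup>2 / \<sigma>\<^sup>2))) w
      \<le> ennreal (exp 1)"
    using assms(1) by (simp add: oracle_A2_def)
  have m: "(\<lambda>w. exp ((norm (Y w - gradf (x w)))\<^sup>2 / \<sigma>\<^sup>2)) \<in> borel_measurable M" by measurable
  show "integrable M (\<lambda>w. u w * exp ((norm (Y w - gradf (x w)))\<^sup>2 / \<sigma>\<^sup>2))"
    by (rule integral_le_of_nn_cond_exp_le(1)[OF m exp_ge_zero AE exp_ge_zero assms(2-4)])
  show "(\<integral>w. u w * exp ((norm (Y w - gradf (x w)))\<^sup>2 / \<sigma>\<^sup>2) \<partial>M) \<le> exp 1 * (\<integral>w. u w \<partial>M)"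
    by (rule integral_le_of_nn_cond_exp_le(2)[OF m exp_ge_zero AE exp_ge_zero assms(2-4)])
qed

text \<open>Neither \<open>Y\<close> nor \<open>gradf (x w)\<close> need be integrable, so the conditional mean is first used on the
  events where \<open>gradf (x w)\<close> and \<open>v\<close> are bounded.\<close>

lemma oracle_A1_centered:
  assumes A1: "oracle_A1 M F gradf \<sigma> x Y" and v: "v \<in> borel_measurable F"
    and int: "integrable M (\<lambda>w. v w \<bullet> (Y w - gradf (x w)))"
  shows "(\<integral>w. v w \<bullet> (Y w - gradf (x w)) \<partial>M) = 0"
proof -
  define g where "g w = gradf (x w)" for w
  define \<delta> where "\<delta> w = Y w - g w" for w
  note [measurable] = Y_meas grad_meas[folded g_def] grad_meas_M[folded g_def] v measurable_from_subalg[OF sub v]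
  have \<delta>_meas [measurable]: "\<delta> \<in> borel_measurable M" unfolding \<delta>_def by measurable
  have sq: "integrable M (\<lambda>w. (norm (\<delta> w))\<^sup>2)"
    using oracle_A1_square[OF A1] by (simp add: \<delta>_def g_def)
  have n\<delta>: "integrable M (\<lambda>w. norm (\<delta> w))"
  proof (rule Bochner_Integration.integrable_bound[OF Bochner_Integration.integrable_add[OF sq integrable_const[of 1]]])
    have "norm (\<delta> w) \<le> (norm (\<delta> w))\<^sup>2 + 1" for w
    proof -
      have "2 * norm (\<delta> w) \<le> (norm (\<delta> w))\<^sup>2 + 1" using sum_squares_bound[of "norm (\<delta> w)" 1] by simp
      then show ?thesis using norm_ge_zero[of "\<delta> w"] by linarith
    qed
    then show "AE w in M. norm (norm (\<delta> w)) \<le> norm ((norm (\<delta> w))\<^sup>2 + 1)" by simp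
  qed measurable
  define \<phi> where "\<phi> n w = (if norm (g w) \<le> real n \<and> norm (v w) \<le> real n then 1 else (0::real))" for n w
  have \<phi>_meas [measurable]: "\<phi> n \<in> borel_measurable F" "\<phi> n \<in> borel_measurable M" for n
    unfolding \<phi>_def by measurable
  have zero: "integrable M (\<lambda>w. \<phi> n w * (v w \<bullet> b) * (\<delta> w \<bullet> b)) \<and> (\<integral>w. \<phi> n w * (v w \<bullet> b) * (\<delta> w \<bullet> b) \<partial>M) = 0"
    if b: "b \<in> Basis" for n b
  proof -
    let ?f = "\<lambda>w. \<phi> n w * (v w \<bullet> b)"
    have f: "\<bar>?f w\<bar> \<le> real n" for w
      using Basis_le_norm[OF b, of "v w"] by (auto simp: \<phi>_def)
    have \<delta>b: "integrable M (\<lambda>w. ?f w * (\<delta> w \<bullet> b))"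
    proof (rule Bochner_Integration.integrable_bound[OF integrable_mult_right[OF n\<delta>, of "real n"]])
      have "\<bar>?f w * (\<delta> w \<bullet> b)\<bar> \<le> real n * norm (\<delta> w)" for w
        unfolding abs_mult[of "?f w"] using f[of w] Basis_le_norm[OF b, of "\<delta> w"] by (intro mult_mono) auto
      then show "AE w in M. norm (?f w * (\<delta> w \<bullet> b)) \<le> norm (real n * norm (\<delta> w))" by simp
    qed measurable
    have gb: "integrable M (\<lambda>w. ?f w * (g w \<bullet> b))"
    proof (rule Bochner_Integration.integrable_bound[OF integrable_const[of "real n * real n"]])
      have "\<bar>?f w * (g w \<bullet> b)\<bar> \<le> real n * real n" for w
      proof (cases "norm (g w) \<le> real n")
        case True
        then show ?thesis
          unfolding abs_mult[of "?f w"] using f[of w] Basis_le_norm[OF b, of "g w"] by (intro mult_mono) auto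
      qed (simp add: \<phi>_def)
      then show "AE w in M. norm (?f w * (g w \<bullet> b)) \<le> norm (real n * real n)" by simp
    qed measurable
    \<comment> \<open>The truncation makes both parts of \<open>Y\<close> integrable against the
      weight, which justifies splitting the integral and cancelling the gradient part.\<close>
    have Yb: "(\<lambda>w. ?f w * (Y w \<bullet> b)) = (\<lambda>w. ?f w * (\<delta> w \<bullet> b) + ?f w * (g w \<bullet> b))"
      by (auto simp: \<delta>_def inner_diff_left algebra_simps)
    have "integrable M (\<lambda>w. ?f w * (Y w \<bullet> b))"
      unfolding Yb using \<delta>b gb by simp
    then have "(\<integral>w. ?f w * real_cond_exp M F (\<lambda>w. Y w \<bullet> b) w \<partial>M) = (\<integral>w. ?f w * (Y w \<bullet> b) \<partial>M)"
      by (rule real_cond_exp_intg(2)) measurable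
    moreover have "(\<integral>w. ?f w * real_cond_exp M F (\<lambda>w. Y w \<bullet> b) w \<partial>M) = (\<integral>w. ?f w * (g w \<bullet> b) \<partial>M)"
    proof (rule integral_cong_AE)
      have "AE w in M. vec_cond_exp M F Y w = g w" using A1 by (simp add: oracle_A1_def g_def)
      then show "AE w in M. ?f w * real_cond_exp M F (\<lambda>w. Y w \<bullet> b) w = ?f w * (g w \<bullet> b)"
      proof eventually_elim
        case (elim w)
        have "vec_cond_exp M F Y w \<bullet> b = real_cond_exp M F (\<lambda>w. Y w \<bullet> b) w"
          using b by (simp add: vec_cond_exp_def)
        then show ?case using elim by simp
      qed
    qed measurable
    ultimately show ?thesis using \<delta>b gb unfolding Yb by simp
  qed
  have sum: "\<phi> n w * (v w \<bullet> \<delta> w) = (\<Sum>b\<in>Basis. \<phi> n w * (v w \<bullet> b) * (\<delta> w \<bullet> b))" for n w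
    by (subst euclidean_inner) (simp add: sum_distrib_left mult.assoc)
  have "(\<integral>w. \<phi> n w * (v w \<bullet> \<delta> w) \<partial>M) = 0" for n
    unfolding sum using zero by (subst Bochner_Integration.integral_sum) auto
  \<comment> \<open>The truncation is removed by dominated convergence, with the majorant provided
    by \<open>int\<close>.\<close>
  moreover have "(\<lambda>n. \<integral>w. \<phi> n w * (v w \<bullet> \<delta> w) \<partial>M) \<longlonglongrightarrow> (\<integral>w. v w \<bullet> \<delta> w \<partial>M)"
  proof (rule integral_dominated_convergence)
    show "integrable M (\<lambda>w. \<bar>v w \<bullet> \<delta> w\<bar>)" using int by (simp add: \<delta>_def g_def)
    show "AE w in M. (\<lambda>n. \<phi> n w * (v w \<bullet> \<delta> w)) \<longlonglongrightarrow> v w \<bullet> \<delta> w"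
    proof (rule AE_I2)
      fix w
      obtain n0 :: nat where n0: "max (norm (g w)) (norm (v w)) \<le> real n0" using real_arch_simple by blast
      have "\<forall>\<^sub>F n in sequentially. \<phi> n w * (v w \<bullet> \<delta> w) = v w \<bullet> \<delta> w"
        unfolding eventually_sequentially by (rule exI[of _ n0]) (use n0 in \<open>auto simp: \<phi>_def\<close>)
      then show "(\<lambda>n. \<phi> n w * (v w \<bullet> \<delta> w)) \<longlonglongrightarrow> v w \<bullet> \<delta> w"
        by (rule tendsto_eventually)
    qed
    show "AE w in M. norm (\<phi> n w * (v w \<bullet> \<delta> w)) \<le> \<bar>v w \<bullet> \<delta> w\<bar>" for n by (simp add: \<phi>_def)
  qed measurable
  ultimately show ?thesis by (simp add: LIMSEQ_const_iff \<delta>_def g_def)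
qed

end

text \<open>The point \<open>x\<close> stays the same for all calls, as it does within one batch and
  for the post-optimization sample of one candidate.\<close>

lemma noise_sequence_oracle:
  fixes gradf :: "'a::euclidean_space \<Rightarrow> 'a" and x :: "'w \<Rightarrow> 'a" and Y :: "nat \<Rightarrow> 'w \<Rightarrow> 'a"
  assumes M: "prob_space M" and \<sigma>: "\<sigma> > 0"
    and sub: "\<And>k. k \<in> {1..n} \<Longrightarrow> subalgebra M (F k)"
    and Y: "\<And>k. k \<in> {1..n} \<Longrightarrow> Y k \<in> borel_measurable M"
    and g: "\<And>k. k \<in> {1..n} \<Longrightarrow> (\<lambda>w. gradf (x w)) \<in> borel_measurable (F k)"
    and adapted: "\<And>j k. k \<in> {1..n} \<Longrightarrow> j \<in> {1..<k} \<Longrightarrow> Y j \<in> borel_measurable (F k)"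
    and A1: "\<And>k. k \<in> {1..n} \<Longrightarrow> oracle_A1 M (F k) gradf \<sigma> x (Y k)"
    and A2: "\<And>k. k \<in> {1..n} \<Longrightarrow> oracle_A2 M (F k) gradf \<sigma> x (Y k)"
  shows "noise_sequence M F (\<lambda>k w. Y k w - gradf (x w)) \<sigma> n"
proof (intro noise_sequence.intro M noise_sequence_axioms.intro \<sigma>)
  fix k assume k: "k \<in> {1..n}"
  show "subalgebra M (F k)" by (rule sub[OF k])
  show "(\<lambda>w. Y k w - gradf (x w)) \<in> borel_measurable M"
    by (intro borel_measurable_diff Y k measurable_from_subalg[OF sub[OF k] g[OF k]])
  show "(\<lambda>w. Y j w - gradf (x w)) \<in> borel_measurable (F k)" if "j \<in> {1..<k}" for j
    by (intro borel_measurable_diff adapted[OF k that] g[OF k])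
  note * = M sub[OF k] Y[OF k] g[OF k]
  show "(\<integral>w. v w \<bullet> (Y k w - gradf (x w)) \<partial>M) = 0"
    if "v \<in> borel_measurable (F k)" "integrable M (\<lambda>w. v w \<bullet> (Y k w - gradf (x w)))" for v
    by (rule oracle_A1_centered[OF * A1[OF k] that])
  show "integrable M (\<lambda>w. (norm (Y k w - gradf (x w)))\<^sup>2)"
    "(\<integral>w. (norm (Y k w - gradf (x w)))\<^sup>2 \<partial>M) \<le> \<sigma>\<^sup>2"
    by (rule oracle_A1_square[OF * A1[OF k]])+
  show "integrable M (\<lambda>w. u w * exp ((norm (Y k w - gradf (x w)))\<^sup>2 / \<sigma>\<^sup>2))"
    "(\<integral>w. u w * exp ((norm (Y k w - gradf (x w)))\<^sup>2 / \<sigma>\<^sup>2) \<partial>M) \<le> exp 1 * (\<integral>w. u w \<partial>M)"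
    if "u \<in> borel_measurable (F k)" "\<And>w. 0 \<le> u w" "integrable M u" for u
    by (rule oracle_A2_exp[OF * A2[OF k] that])+
qed

section \<open>The two-phase algorithm\<close>

text \<open>Lets an iterate be computed from the restricted sample family
  \<open>samples s run_calls\<close>, about which the independence assumptions speak.\<close>

lemma rspg_iterate_cong:
  assumes "\<And>k' i. k' \<in> {1..<k} \<Longrightarrow> i \<in> {1..m k'} \<Longrightarrow> \<eta> k' i = \<eta>' k' i"
  shows "rspg_iterate prox G \<gamma> m x1 \<eta> k = rspg_iterate prox G \<gamma> m x1 \<eta>' k"
  using assms
proof (induction k)
  case (Suc k)
  show ?case
  proof (cases k)
    case (Suc n)
    have "oracle_mean G x (m k) (\<eta> k) = oracle_mean G x (m k) (\<eta>' k)" for x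
      using Suc.prems Suc by (simp add: oracle_mean_def)
    then show ?thesis using Suc.IH Suc.prems Suc by (simp add: Let_def)
  qed simp
qed simp

section \<open>Rounding of the batch size and the iteration limit\<close>

lemma batch_size_bounds:
  assumes "L > 0" "\<sigma> > 0" "Dt > 0" "Nbar \<ge> 1"
  defines "a \<equiv> \<sigma> * sqrt (6 * real Nbar) / (4 * L * Dt)"
  shows "1 \<le> batch_size L \<sigma> Dt Nbar" "batch_size L \<sigma> Dt Nbar \<le> Nbar"
    "real (batch_size L \<sigma> Dt Nbar) \<le> 1 + a" "min a (real Nbar) \<le> real (batch_size L \<sigma> Dt Nbar)"
proof -
  let ?v = "min (max 1 a) (real Nbar)"
  have a: "a > 0" unfolding a_def using assms(1-4) by simp
  have m: "batch_size L \<sigma> Dt Nbar = nat \<lceil>?v\<rceil>" by (simp add: batch_size_def a_def)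
  have v1: "?v \<ge> 1" using assms(4) by simp
  have "1 \<le> \<lceil>?v\<rceil>" using v1 by linarith
  then show "1 \<le> batch_size L \<sigma> Dt Nbar" unfolding m by linarith
  have rm: "real (batch_size L \<sigma> Dt Nbar) = of_int \<lceil>?v\<rceil>" unfolding m using \<open>1 \<le> \<lceil>?v\<rceil>\<close> by simp
  have "\<lceil>?v\<rceil> \<le> int Nbar" by (simp add: ceiling_le_iff)
  then show "batch_size L \<sigma> Dt Nbar \<le> Nbar" unfolding m by linarith
  show "real (batch_size L \<sigma> Dt Nbar) \<le> 1 + a"
  proof (cases "a \<le> 1")
    case True
    then have "?v \<le> 1" by auto
    then have "\<lceil>?v\<rceil> \<le> 1" by (simp add: ceiling_le_iff)
    then show ?thesis unfolding rm using a by linarith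
  next
    case False
    then have "?v \<le> a" by auto
    then show ?thesis unfolding rm using ceiling_correct[of ?v] by linarith
  qed
  have "min a (real Nbar) \<le> ?v" by auto
  then show "min a (real Nbar) \<le> real (batch_size L \<sigma> Dt Nbar)" unfolding rm by linarith
qed

text \<open>Since \<open>m\<close> is at most \<open>Nbar\<close> the quotient is at least 1, so the
  remainder, which is below \<open>m\<close>, is covered by doubling the quotient. This is the only
  loss from rounding down.\<close>

lemma iteration_limit_bounds:
  assumes "1 \<le> batch_size L \<sigma> Dt Nbar" "batch_size L \<sigma> Dt Nbar \<le> Nbar"
  shows "1 \<le> iteration_limit L \<sigma> Dt Nbar" "iteration_limit L \<sigma> Dt Nbar * batch_size L \<sigma> Dt Nbar \<le> Nbar"
    "Nbar \<le> 2 * iteration_limit L \<sigma> Dt Nbar * batch_size L \<sigma> Dt Nbar"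
proof -
  define m where "m = batch_size L \<sigma> Dt Nbar"
  have N: "iteration_limit L \<sigma> Dt Nbar = Nbar div m"
    by (simp add: iteration_limit_def m_def floor_divide_of_nat_eq)
  have m: "1 \<le> m" "m \<le> Nbar" using assms by (auto simp: m_def)
  then show N1: "1 \<le> iteration_limit L \<sigma> Dt Nbar" unfolding N using div_le_mono[of m Nbar m] by simp
  show "iteration_limit L \<sigma> Dt Nbar * batch_size L \<sigma> Dt Nbar \<le> Nbar" unfolding N m_def[symmetric] by simp
  have "Nbar < (Nbar div m) * m + m" using m div_mult_mod_eq[of Nbar m] mod_less_divisor[of m Nbar] by linarith
  also have "\<dots> \<le> (Nbar div m) * m + (Nbar div m) * m" using N1 unfolding N by simp
  finally show "Nbar \<le> 2 * iteration_limit L \<sigma> Dt Nbar * batch_size L \<sigma> Dt Nbar"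
    unfolding N m_def[symmetric] by simp
qed

text \<open>The left side is the mean bound for one run, up to the factor
  \<open>\<alpha>\<^sup>2\<close>. Its first term grows with the batch size like
  \<open>m / Nbar\<close> and its second decays like \<open>1 / m\<close>. The unrounded size
  \<open>a\<close> is of order \<open>sqrt Nbar\<close> and balances them. The first term uses
  \<open>m \<le> 1 + a\<close>, the second \<open>min a Nbar \<le> m\<close>.\<close>

lemma B_Nbar_bound:
  fixes L \<sigma> Dt D :: real
  assumes L: "L > 0" and \<sigma>: "\<sigma> > 0" and Dt: "Dt > 0" and Nbar: "Nbar \<ge> 1"
  defines "m \<equiv> batch_size L \<sigma> Dt Nbar" and "N \<equiv> iteration_limit L \<sigma> Dt Nbar"
  shows "8 * L\<^sup>2 * D\<^sup>2 / real N + 6 * \<sigma>\<^sup>2 / real m \<le> L * B_Nbar L \<sigma> Dt D Nbar"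
proof -
  define r where "r = sqrt (real Nbar)"
  define q where "q = sqrt (6::real)"
  define a where "a = \<sigma> * sqrt (6 * real Nbar) / (4 * L * Dt)"
  have r: "r > 0" "r * r = real Nbar" using Nbar by (auto simp: r_def)
  have q: "q > 0" "q * q = 6" by (auto simp: q_def)
  have a: "a = \<sigma> * q * r / (4 * L * Dt)" by (simp add: a_def q_def r_def real_sqrt_mult)
  have a0: "a > 0" unfolding a using L \<sigma> Dt q r by simp
  note mb = batch_size_bounds[OF L \<sigma> Dt Nbar, folded m_def a_def]
  note Nb = iteration_limit_bounds[OF mb(1,2)[unfolded m_def], folded m_def N_def]
  have "real Nbar \<le> real (2 * N * m)" using Nb(3) by (simp only: of_nat_le_iff)
  then have "8 * L\<^sup>2 * D\<^sup>2 * real Nbar \<le> 8 * L\<^sup>2 * D\<^sup>2 * (2 * real N * real m)"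
    by (intro mult_left_mono) auto
  then have "8 * L\<^sup>2 * D\<^sup>2 / real N \<le> 16 * L\<^sup>2 * D\<^sup>2 * real m / real Nbar"
    using Nb(1) Nbar by (simp add: field_simps)
  also have "\<dots> \<le> 16 * L\<^sup>2 * D\<^sup>2 * (1 + a) / real Nbar"
    using mb(3) by (intro divide_right_mono mult_left_mono) auto
  also have "\<dots> = L * (16 * L * D\<^sup>2 / real Nbar + 4 * q * \<sigma> / r * (D\<^sup>2 / Dt))"
    unfolding a r(2)[symmetric] using L Dt r(1) by (simp add: field_simps power2_eq_square)
  finally have 1: "8 * L\<^sup>2 * D\<^sup>2 / real N \<le> L * (16 * L * D\<^sup>2 / real Nbar + 4 * q * \<sigma> / r * (D\<^sup>2 / Dt))" .
  have "6 * \<sigma>\<^sup>2 / real m \<le> 6 * \<sigma>\<^sup>2 / min a (real Nbar)"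
    using mb(4) a0 Nbar by (intro divide_left_mono) auto
  also have "\<dots> \<le> L * (4 * q * \<sigma> / r * (Dt * max 1 (q * \<sigma> / (4 * L * Dt * r))))"
  proof (cases "a \<le> real Nbar")
    case True
    have "6 * \<sigma>\<^sup>2 / a = L * (4 * q * \<sigma> / r * Dt)"
      unfolding a q(2)[symmetric] using L \<sigma> Dt r(1) q(1) by (simp add: field_simps power2_eq_square)
    also have "\<dots> \<le> L * (4 * q * \<sigma> / r * (Dt * max 1 (q * \<sigma> / (4 * L * Dt * r))))"
      using L \<sigma> Dt r q by (intro mult_left_mono) (auto intro!: mult_le_cancel_left1[THEN iffD2])
    finally show ?thesis using True by (simp add: min_def)
  next
    \<comment> \<open>When \<open>a\<close> exceeds \<open>Nbar\<close>, the batch size is cut off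
      at \<open>Nbar\<close>. This is exactly when the second argument of \<open>max\<close> exceeds
      1, and that argument accounts for the lost variance reduction.\<close>
    case False
    have "6 * \<sigma>\<^sup>2 / real Nbar = L * (4 * q * \<sigma> / r * (Dt * (q * \<sigma> / (4 * L * Dt * r))))"
      unfolding r(2)[symmetric] q(2)[symmetric] using L \<sigma> Dt r(1) q(1) by (simp add: field_simps power2_eq_square)
    also have "\<dots> \<le> L * (4 * q * \<sigma> / r * (Dt * max 1 (q * \<sigma> / (4 * L * Dt * r))))"
      using L \<sigma> Dt r q by (intro mult_left_mono) auto
    finally show ?thesis using False by (simp add: min_def)
  qed
  finally have 2: "6 * \<sigma>\<^sup>2 / real m \<le> L * (4 * q * \<sigma> / r * (Dt * max 1 (q * \<sigma> / (4 * L * Dt * r))))" .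
  have "L * B_Nbar L \<sigma> Dt D Nbar = L * (16 * L * D\<^sup>2 / real Nbar + 4 * q * \<sigma> / r * (D\<^sup>2 / Dt))
      + L * (4 * q * \<sigma> / r * (Dt * max 1 (q * \<sigma> / (4 * L * Dt * r))))"
    unfolding B_Nbar_def q_def[symmetric] r_def[symmetric] by (simp add: distrib_left)
  then show ?thesis using 1 2 by linarith
qed

lemma B_Nbar_pos:
  assumes "L > 0" "\<sigma> > 0" "Dt > 0" "Nbar \<ge> 1"
  shows "B_Nbar L \<sigma> Dt D Nbar > 0"
  unfolding B_Nbar_def using assms
  by (intro add_nonneg_pos mult_pos_pos divide_pos_pos add_nonneg_pos) (auto simp: less_max_iff_disj)

section \<open>Measurability of the iterates and the noise within one batch\<close>

context two_rspg
begin

text \<open>Points are tracked as maps into this space because measurability of \<open>G\<close> and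
  continuity of \<open>gradf\<close> and of the prox-mapping are available on \<open>X\<close>
  only.\<close>

abbreviation "borel_X \<equiv> restrict_space borel X"
abbreviation "gX x \<equiv> pgrad x (gradf x) \<gamma>"

lemma stepsize_pos: "\<gamma> > 0"
  using \<alpha>_pos L_pos by (simp add: \<gamma>_def)

lemma m_N_bounds: "1 \<le> m" "1 \<le> N" "N * m \<le> Nbar"
  using batch_size_bounds(1,2)[OF L_pos \<sigma>_pos Dt_pos Nbar_pos]
    iteration_limit_bounds(1,2)[of L \<sigma> Dt Nbar] by (auto simp: m_def N_def)

lemma oracle_measurable:
  assumes "x \<in> K \<rightarrow>\<^sub>M borel_X" "\<eta> \<in> K \<rightarrow>\<^sub>M \<Xi>"
  shows "(\<lambda>v. G (x v) (\<eta> v)) \<in> borel_measurable K"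
  using measurable_compose[OF measurable_Pair[OF assms] G_measurable] by simp

lemma gradf_measurable:
  assumes "x \<in> K \<rightarrow>\<^sub>M borel_X"
  shows "(\<lambda>v. gradf (x v)) \<in> borel_measurable K"
  using f_C1 unfolding C1_on_def
  by (intro measurable_compose[OF assms] borel_measurable_continuous_on_restrict) auto

lemma gX_measurable:
  assumes "x \<in> K \<rightarrow>\<^sub>M borel_X"
  shows "(\<lambda>v. gX (x v)) \<in> borel_measurable K"
  by (intro measurable_compose[OF assms] borel_measurable_continuous_on_restrict
      continuous_on_pgrad_gradf[OF stepsize_pos])

lemma in_X_if_measurable: "x \<in> K \<rightarrow>\<^sub>M borel_X \<Longrightarrow> v \<in> space K \<Longrightarrow> x v \<in> X"
  using measurable_space[of x K borel_X v] by (simp add: space_restrict_space)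

lemma prox_measurable:
  assumes x: "x \<in> K \<rightarrow>\<^sub>M borel_X" and g: "g \<in> borel_measurable K"
  shows "(\<lambda>v. prox (x v) (g v) \<gamma>) \<in> K \<rightarrow>\<^sub>M borel_X"
proof (rule measurable_restrict_space2)
  have xb: "x \<in> borel_measurable K" using x measurable_restrict_space2_iff by blast
  have "(\<lambda>v. (x v, g v)) \<in> K \<rightarrow>\<^sub>M restrict_space borel (X \<times> UNIV)"
    using xb g in_X_if_measurable[OF x] by (intro measurable_restrict_space2 borel_measurable_Pair) auto
  from measurable_compose[OF this borel_measurable_continuous_on_restrict[OF continuous_on_prox[OF stepsize_pos]]]
  show "(\<lambda>v. prox (x v) (g v) \<gamma>) \<in> borel_measurable K" by simp
  show "(\<lambda>v. prox (x v) (g v) \<gamma>) \<in> space K \<rightarrow> X"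
    using in_X_if_measurable[OF x] prox_in[OF _ stepsize_pos] by auto
qed

lemma oracle_mean_measurable:
  assumes "x \<in> K \<rightarrow>\<^sub>M borel_X" "\<And>i. i \<in> {1..n} \<Longrightarrow> \<eta> i \<in> K \<rightarrow>\<^sub>M \<Xi>"
  shows "(\<lambda>v. oracle_mean G (x v) n (\<lambda>i. \<eta> i v)) \<in> borel_measurable K"
  unfolding oracle_mean_def
  by (intro borel_measurable_scaleR borel_measurable_const borel_measurable_sum oracle_measurable assms)

text \<open>The source \<open>K\<close> is left open: it is instantiated by \<open>M\<close>, by the
  histories and by the product space of all samples of a run.\<close>

lemma rspg_iterate_measurable:
  assumes "\<And>k' i. k' \<in> {1..<k} \<Longrightarrow> i \<in> {1..m} \<Longrightarrow> \<eta> k' i \<in> K \<rightarrow>\<^sub>M \<Xi>"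
  shows "(\<lambda>v. rspg_iterate prox G (\<lambda>_. \<gamma>) (\<lambda>_. m) x1 (\<lambda>k i. \<eta> k i v) k) \<in> K \<rightarrow>\<^sub>M borel_X"
  using assms
proof (induction k)
  case 0
  show ?case using x1_in by (simp add: space_restrict_space)
next
  case (Suc k)
  show ?case
  proof (cases k)
    case 0
    then show ?thesis using x1_in by (simp add: space_restrict_space)
  next
    case (Suc n)
    then show ?thesis
      using prox_measurable[OF Suc.IH oracle_mean_measurable[OF Suc.IH, of m "\<eta> k"]] Suc.prems
      by (simp add: Let_def)
  qed
qed

lemma iterate_measurable:
  assumes "\<And>k' i. k' \<in> {1..<k} \<Longrightarrow> i \<in> {1..m} \<Longrightarrow> \<xi> s k' i \<in> K \<rightarrow>\<^sub>M \<Xi>"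
  shows "iterate s k \<in> K \<rightarrow>\<^sub>M borel_X"
  unfolding iterate_def[abs_def] using assms by (rule rspg_iterate_measurable)

lemma iterate_measurable_M: "s \<in> {1..S} \<Longrightarrow> k \<le> N \<Longrightarrow> iterate s k \<in> M \<rightarrow>\<^sub>M borel_X"
  by (rule iterate_measurable) (rule \<xi>_measurable, auto simp: run_calls_def)

lemma samples_measurable:
  assumes "s \<in> {1..S}" "I \<subseteq> run_calls"
  shows "samples s I \<in> M \<rightarrow>\<^sub>M PiM I (\<lambda>_. \<Xi>)"
  unfolding samples_def[abs_def] using assms \<xi>_measurable by (intro measurable_restrict) auto

lemma iterate_eq_samples:
  assumes "k \<le> N"
  shows "iterate s k w
    = rspg_iterate prox G (\<lambda>_. \<gamma>) (\<lambda>_. m) x1 (\<lambda>k i. samples s run_calls w (k, i)) k"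
  unfolding iterate_def using assms by (intro rspg_iterate_cong) (auto simp: samples_def run_calls_def)

lemma earlier_subset: "(k, i) \<in> run_calls \<Longrightarrow> earlier k i \<subseteq> run_calls"
  by (auto simp: run_calls_def earlier_def)

lemma history_subalgebra:
  assumes "s \<in> {1..S}" "(k, i) \<in> run_calls"
  shows "subalgebra M (history s k i)"
  using samples_measurable[OF assms(1) earlier_subset[OF assms(2)]]
  unfolding subalgebra_def history_def measurable_iff_sets by simp

lemma sample_history:
  assumes "s \<in> {1..S}" "(k, i) \<in> run_calls" "(k', i') \<in> earlier k i"
  shows "\<xi> s k' i' \<in> history s k i \<rightarrow>\<^sub>M \<Xi>"
proof -
  have "samples s (earlier k i) \<in> history s k i \<rightarrow>\<^sub>M PiM (earlier k i) (\<lambda>_. \<Xi>)"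
    unfolding history_def using samples_measurable[OF assms(1) earlier_subset[OF assms(2)]]
    by (intro measurable_vimage_algebra1) (auto dest: measurable_space)
  from measurable_compose[OF this measurable_component_singleton[OF assms(3)]]
  show ?thesis using assms(3) by (simp add: samples_def)
qed

lemma iterate_history:
  assumes "s \<in> {1..S}" "(k, i) \<in> run_calls"
  shows "iterate s k \<in> history s k i \<rightarrow>\<^sub>M borel_X"
  by (rule iterate_measurable) (rule sample_history[OF assms], auto simp: earlier_def)

lemma noise_sequence_opt:
  assumes s: "s \<in> {1..S}" and k: "k \<in> {1..<N}"
  shows "noise_sequence M (history s k) (\<lambda>i w. G (iterate s k w) (\<xi> s k i w) - gradf (iterate s k w)) \<sigma> m"
proof -
  have rc: "(k, i) \<in> run_calls" if "i \<in> {1..m}" for i using k that by (auto simp: run_calls_def)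
  have Y: "(\<lambda>w. G (iterate s k w) (\<xi> s k i w)) \<in> borel_measurable M" if "i \<in> {1..m}" for i
    using k by (intro oracle_measurable iterate_measurable_M \<xi>_measurable rc s that) auto
  have "(\<lambda>w. G (iterate s k w) (\<xi> s k j w)) \<in> borel_measurable (history s k i)"
    if "i \<in> {1..m}" "j \<in> {1..<i}" for i j
    by (intro oracle_measurable iterate_history sample_history s rc that)
      (use that in \<open>auto simp: earlier_def\<close>)
  then show ?thesis
    by (intro noise_sequence_oracle prob_space_axioms \<sigma>_pos history_subalgebra gradf_measurable
        iterate_history opt_A1 opt_A2 rc s Y) auto
qed

end

text \<open>Leads from the sigma-algebra form of \<open>R_indep\<close> to the random-variable form
  used by the product rule for expectations.\<close>

lemma (in prob_space) indep_var_of_indep_set: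
  assumes ind: "indep_set (sets V) (sets W)" and sp: "space V = space M" "space W = space M"
    and X: "X \<in> V \<rightarrow>\<^sub>M A" and Y: "Y \<in> W \<rightarrow>\<^sub>M B"
  shows "indep_var A X B Y"
  unfolding indep_var_eq
proof (intro conjI indep_setI)
  note ev = indep_setD_ev1[OF ind] indep_setD_ev2[OF ind]
  show "random_variable A X" "random_variable B Y"
    using X Y ev sp unfolding measurable_def by auto
  have sub: "sigma_sets (space M) {X -` a \<inter> space M |a. a \<in> sets A} \<subseteq> sets V"
    "sigma_sets (space M) {Y -` b \<inter> space M |b. b \<in> sets B} \<subseteq> sets W"
    using measurable_sets[OF X] measurable_sets[OF Y]
      sets.sigma_sets_subset[of "{X -` a \<inter> space M |a. a \<in> sets A}" V]
      sets.sigma_sets_subset[of "{Y -` b \<inter> space M |b. b \<in> sets B}" W] unfolding sp by auto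
  then show "sigma_sets (space M) {X -` a \<inter> space M |a. a \<in> sets A} \<subseteq> events"
    "sigma_sets (space M) {Y -` b \<inter> space M |b. b \<in> sets B} \<subseteq> events"
    using ev by auto
  show "prob (a \<inter> b) = prob a * prob b"
    if "a \<in> sigma_sets (space M) {X -` a \<inter> space M |a. a \<in> sets A}"
      "b \<in> sigma_sets (space M) {Y -` b \<inter> space M |b. b \<in> sets B}" for a b
    using that sub by (intro indep_setD[OF ind]) auto
qed

section \<open>Expected squared projected gradient at the output of one run\<close>

context two_rspg
begin

abbreviation "noise s k w \<equiv> oracle_mean G (iterate s k w) m (\<lambda>i. \<xi> s k i w) - gradf (iterate s k w)"

lemma noise_eq:
  "noise s k w = (1 / real m) *\<^sub>R (\<Sum>i\<in>{1..m}. G (iterate s k w) (\<xi> s k i w) - gradf (iterate s k w))"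
  using m_N_bounds(1) by (simp add: oracle_mean_def sum_subtractf scaleR_diff_right sum_constant_scaleR del: sum_constant)

text \<open>Within a batch the errors are martingale differences, so the second moment of their sum
  is at most \<open>m * \<sigma>\<^sup>2\<close>, and averaging divides it by
  \<open>m\<^sup>2\<close>.\<close>

lemma noise_square:
  assumes "s \<in> {1..S}" "k \<in> {1..<N}"
  shows "integrable M (\<lambda>w. (norm (noise s k w))\<^sup>2)"
    "(\<integral>w. (norm (noise s k w))\<^sup>2 \<partial>M) \<le> \<sigma>\<^sup>2 / real m"
proof -
  interpret ns: noise_sequence M "history s k" "\<lambda>i w. G (iterate s k w) (\<xi> s k i w) - gradf (iterate s k w)" \<sigma> m
    by (rule noise_sequence_opt[OF assms])
  have sq: "(norm (noise s k w))\<^sup>2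
      = (1 / real m)\<^sup>2 * (norm (\<Sum>i\<in>{1..m}. G (iterate s k w) (\<xi> s k i w) - gradf (iterate s k w)))\<^sup>2" for w
    unfolding noise_eq norm_scaleR power_mult_distrib by (simp add: power_divide)
  note ps = ns.partial_square[OF order_refl]
  show "integrable M (\<lambda>w. (norm (noise s k w))\<^sup>2)"
    unfolding sq by (rule integrable_mult_right) (use ps in blast)
  have "(\<integral>w. (norm (noise s k w))\<^sup>2 \<partial>M) \<le> (1 / real m)\<^sup>2 * (real m * \<sigma>\<^sup>2)"
    unfolding sq integral_mult_right_zero using ps by (intro mult_left_mono) auto
  also have "\<dots> = \<sigma>\<^sup>2 / real m" using m_N_bounds(1) by (simp add: power2_eq_square)
  finally show "(\<integral>w. (norm (noise s k w))\<^sup>2 \<partial>M) \<le> \<sigma>\<^sup>2 / real m" .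
qed

text \<open>The exact projected gradient at the iterate is determined by samples drawn before the
  batch, so it is an admissible weight for every call of the batch.\<close>

lemma noise_orthogonal:
  assumes s: "s \<in> {1..S}" and k: "k \<in> {1..<N}"
    and g: "integrable M (\<lambda>w. (norm (gX (iterate s k w)))\<^sup>2)"
  shows "integrable M (\<lambda>w. noise s k w \<bullet> gX (iterate s k w))"
    "(\<integral>w. noise s k w \<bullet> gX (iterate s k w) \<partial>M) = 0"
proof -
  let ?\<delta> = "\<lambda>i w. G (iterate s k w) (\<xi> s k i w) - gradf (iterate s k w)"
  let ?g = "\<lambda>w. gX (iterate s k w)"
  interpret ns: noise_sequence M "history s k" ?\<delta> \<sigma> m
    by (rule noise_sequence_opt[OF s k])
  have gF: "?g \<in> borel_measurable (history s k i)" if "i \<in> {1..m}" for i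
    using that k by (intro gX_measurable iterate_history s) (auto simp: run_calls_def)
  have gM: "?g \<in> borel_measurable M"
    using k by (intro gX_measurable iterate_measurable_M s) auto
  have int: "integrable M (\<lambda>w. ?g w \<bullet> ?\<delta> i w)" if i: "i \<in> {1..m}" for i
    by (rule integrable_inner_of_squares[OF gM ns.noise_measurable[OF i] g ns.square_integrable[OF i]])
  have zero: "(\<integral>w. ?g w \<bullet> ?\<delta> i w \<partial>M) = 0" if i: "i \<in> {1..m}" for i
    by (rule ns.centered[OF i gF[OF i] int[OF i]])
  have eq: "noise s k w \<bullet> ?g w = (1 / real m) * (\<Sum>i\<in>{1..m}. ?g w \<bullet> ?\<delta> i w)" for w
    unfolding noise_eq inner_scaleR_left inner_sum_right[symmetric] by (simp only: inner_commute)
  show "integrable M (\<lambda>w. noise s k w \<bullet> ?g w)"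
    unfolding eq using int by (intro integrable_mult_right Bochner_Integration.integrable_sum)
  show "(\<integral>w. noise s k w \<bullet> ?g w \<partial>M) = 0"
    unfolding eq integral_mult_right_zero using int zero
    by (subst Bochner_Integration.integral_sum) auto
qed

lemma iterate_1: "iterate s 1 w = x1"
  by (simp add: iterate_def)

lemma iterate_Suc:
  "k \<ge> 1 \<Longrightarrow> iterate s (Suc k) w
    = prox (iterate s k w) (oracle_mean G (iterate s k w) m (\<lambda>i. \<xi> s k i w)) \<gamma>"
  by (cases k) (auto simp: iterate_def Let_def)

definition gap :: real where "gap = f x1 + h x1 - opt_value X f h"

lemma gap_eq: "gap = L * (D_Psi X f h L x1)\<^sup>2"
proof -
  have "opt_value X f h \<le> f x1 + h x1"
    unfolding opt_value_def using opt_value_finite x1_in by (rule cINF_lower)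
  then have "0 \<le> gap" by (simp add: gap_def)
  then show ?thesis using L_pos by (simp add: D_Psi_def gap_def)
qed

lemma run_bound:
  assumes "n \<ge> 1"
  shows "(\<Sum>k\<in>{1..n}. \<alpha>\<^sup>2 / (8 * L) * (norm (gX (iterate s k w)))\<^sup>2)
    \<le> gap + (\<Sum>k\<in>{1..<n}. \<gamma> * (noise s k w \<bullet> gX (iterate s k w)) + 3 / (4 * L) * (norm (noise s k w))\<^sup>2)"
  using rspg_sum_bound[where x = "\<lambda>k. iterate s k w"
      and g = "\<lambda>k. oracle_mean G (iterate s k w) m (\<lambda>i. \<xi> s k i w)" and n = n,
      folded \<gamma>_def, unfolded iterate_1, OF x1_in iterate_Suc assms]
  by (simp add: gap_def)

text \<open>The pathwise bound for the first \<open>k\<close> iterates dominates the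
  \<open>k\<close>-th squared norm by terms that involve earlier iterates only. Their inner products
  with the noise are integrable by the induction hypothesis.\<close>

lemma gX_square_integrable:
  assumes s: "s \<in> {1..S}" and "k \<in> {1..N}"
  shows "integrable M (\<lambda>w. (norm (gX (iterate s k w)))\<^sup>2)"
  using assms(2)
proof (induction k rule: less_induct)
  case (less k)
  let ?B = "\<lambda>w. gap + (\<Sum>j\<in>{1..<k}. \<gamma> * (noise s j w \<bullet> gX (iterate s j w)) + 3 / (4 * L) * (norm (noise s j w))\<^sup>2)"
  let ?A = "\<lambda>w. \<alpha>\<^sup>2 / (8 * L) * (norm (gX (iterate s k w)))\<^sup>2"
  have [measurable]: "(\<lambda>w. gX (iterate s k w)) \<in> borel_measurable M"
    using less.prems by (intro gX_measurable iterate_measurable_M s) auto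
  have "integrable M (\<lambda>w. noise s j w \<bullet> gX (iterate s j w))" "integrable M (\<lambda>w. (norm (noise s j w))\<^sup>2)"
    if "j \<in> {1..<k}" for j
    using that less by (auto intro!: noise_orthogonal noise_square s)
  then have B: "integrable M ?B"
    by (intro Bochner_Integration.integrable_add integrable_const Bochner_Integration.integrable_sum
        integrable_mult_right)
  have le: "?A w \<le> ?B w" for w
  proof -
    have "?A w \<le> (\<Sum>j\<in>{1..k}. \<alpha>\<^sup>2 / (8 * L) * (norm (gX (iterate s j w)))\<^sup>2)"
      using less.prems L_pos
      by (intro member_le_sum[where f = "\<lambda>j. \<alpha>\<^sup>2 / (8 * L) * (norm (gX (iterate s j w)))\<^sup>2"]) auto
    also have "\<dots> \<le> ?B w" using less.prems by (intro run_bound) auto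
    finally show ?thesis .
  qed
  have "integrable M ?A"
  proof (rule Bochner_Integration.integrable_bound[OF B])
    show "AE w in M. norm (?A w) \<le> norm (?B w)"
    proof (rule AE_I2)
      fix w
      have "norm (?A w) = ?A w" using L_pos by simp
      also have "\<dots> \<le> norm (?B w)" using le[of w] by simp
      finally show "norm (?A w) \<le> norm (?B w)" .
    qed
  qed measurable
  then have "integrable M (\<lambda>w. 8 * L / \<alpha>\<^sup>2 * ?A w)" by (rule integrable_mult_right)
  moreover have "8 * L / \<alpha>\<^sup>2 * ?A w = (norm (gX (iterate s k w)))\<^sup>2" for w
    using L_pos \<alpha>_pos by simp
  ultimately show ?case by (simp only:)
qed

lemma expected_run_bound:
  assumes s: "s \<in> {1..S}"
  shows "(\<Sum>k\<in>{1..N}. \<integral>w. (norm (gX (iterate s k w)))\<^sup>2 \<partial>M)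
    \<le> 8 * L / \<alpha>\<^sup>2 * (gap + real N * (3 / (4 * L) * (\<sigma>\<^sup>2 / real m)))"
proof -
  let ?A = "\<lambda>k w. \<alpha>\<^sup>2 / (8 * L) * (norm (gX (iterate s k w)))\<^sup>2"
  let ?B = "\<lambda>k w. \<gamma> * (noise s k w \<bullet> gX (iterate s k w)) + 3 / (4 * L) * (norm (noise s k w))\<^sup>2"
  note orth = noise_orthogonal[OF s _ gX_square_integrable[OF s]]
  have A: "integrable M (?A k)" if "k \<in> {1..N}" for k
    using gX_square_integrable[OF s that] by simp
  have B: "integrable M (?B k)" if "k \<in> {1..<N}" for k
    using that orth(1)[of k] noise_square(1)[OF s that] by auto
  have sumB: "integrable M (\<lambda>w. gap + (\<Sum>k\<in>{1..<N}. ?B k w))"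
    by (rule Bochner_Integration.integrable_add[OF integrable_const Bochner_Integration.integrable_sum[OF B]])
  have "\<alpha>\<^sup>2 / (8 * L) * (\<Sum>k\<in>{1..N}. \<integral>w. (norm (gX (iterate s k w)))\<^sup>2 \<partial>M) = (\<Sum>k\<in>{1..N}. \<integral>w. ?A k w \<partial>M)"
    unfolding sum_distrib_left by (intro sum.cong refl integral_mult_right_zero[symmetric])
  also have "\<dots> = (\<integral>w. (\<Sum>k\<in>{1..N}. ?A k w) \<partial>M)"
    using A by (intro Bochner_Integration.integral_sum[symmetric])
  also have "\<dots> \<le> (\<integral>w. gap + (\<Sum>k\<in>{1..<N}. ?B k w) \<partial>M)"
    using A m_N_bounds(2) by (intro integral_mono run_bound sumB Bochner_Integration.integrable_sum)
  also have "\<dots> = gap + (\<Sum>k\<in>{1..<N}. \<integral>w. ?B k w \<partial>M)"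
    using B by (subst Bochner_Integration.integral_add)
      (auto simp: prob_space intro!: Bochner_Integration.integral_sum)
  also have "\<dots> \<le> gap + (\<Sum>k\<in>{1..<N}. 3 / (4 * L) * (\<sigma>\<^sup>2 / real m))"
  proof (intro add_left_mono sum_mono)
    fix k assume k: "k \<in> {1..<N}"
    then have kN: "k \<in> {1..N}" by auto
    have "(\<integral>w. ?B k w \<partial>M) = \<gamma> * 0 + 3 / (4 * L) * (\<integral>w. (norm (noise s k w))\<^sup>2 \<partial>M)"
      using orth[OF k kN] noise_square(1)[OF s k]
      by (subst Bochner_Integration.integral_add) auto
    also have "\<dots> \<le> \<gamma> * 0 + 3 / (4 * L) * (\<sigma>\<^sup>2 / real m)"
      using noise_square(2)[OF s k] L_pos by (intro add_left_mono mult_left_mono) auto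
    finally show "(\<integral>w. ?B k w \<partial>M) \<le> 3 / (4 * L) * (\<sigma>\<^sup>2 / real m)" by simp
  qed
  also have "\<dots> = gap + real (N - 1) * (3 / (4 * L) * (\<sigma>\<^sup>2 / real m))" by simp
  \<comment> \<open>Only \<open>N - 1\<close> batches contribute. Enlarging to \<open>N\<close> lets
    the factor cancel against the weight \<open>1 / N\<close> of the random index.\<close>
  also have "\<dots> \<le> gap + real N * (3 / (4 * L) * (\<sigma>\<^sup>2 / real m))"
    using L_pos by (intro add_left_mono mult_right_mono) auto
  finally have "8 * L / \<alpha>\<^sup>2 * (\<alpha>\<^sup>2 / (8 * L) * (\<Sum>k\<in>{1..N}. \<integral>w. (norm (gX (iterate s k w)))\<^sup>2 \<partial>M))
      \<le> 8 * L / \<alpha>\<^sup>2 * (gap + real N * (3 / (4 * L) * (\<sigma>\<^sup>2 / real m)))"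
    using L_pos by (intro mult_left_mono) auto
  then show ?thesis using L_pos \<alpha>_pos by simp
qed

text \<open>With a constant stepsize all weights coincide, and their common value
  \<open>\<alpha>\<^sup>2 / (4 * L)\<close> is nonzero, so it cancels and the index is
  uniform.\<close>

lemma R_probability:
  assumes "s \<in> {1..S}" "k \<in> {1..N}"
  shows "\<P>(w in M. R s w = k) = 1 / real N"
proof -
  have "\<alpha> * \<gamma> - L * \<gamma>\<^sup>2 = \<alpha>\<^sup>2 / (4 * L)"
    using L_pos by (simp add: \<gamma>_def power2_eq_square field_simps)
  then have "\<alpha> * \<gamma> - L * \<gamma>\<^sup>2 > 0" using L_pos \<alpha>_pos by simp
  then show ?thesis unfolding R_prob[OF assms] rspg_prob_def using m_N_bounds(2) by simp
qed

lemma indep_R_samples: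
  fixes u :: "nat \<Rightarrow> real"
  assumes s: "s \<in> {1..S}" and v: "v \<in> borel_measurable (PiM run_calls (\<lambda>_. \<Xi>))"
  shows "indep_var borel (\<lambda>w. u (R s w)) borel (\<lambda>w. v (samples s run_calls w))"
proof (rule indep_var_of_indep_set[OF R_indep[OF s]])
  have "R s \<in> vimage_algebra (space M) (R s) (count_space UNIV) \<rightarrow>\<^sub>M count_space UNIV"
    by (rule measurable_vimage_algebra1) simp
  then show "(\<lambda>w. u (R s w)) \<in> borel_measurable (vimage_algebra (space M) (R s) (count_space UNIV))"
    by (rule measurable_compose) simp
  have "samples s run_calls \<in> vimage_algebra (space M) (samples s run_calls) (PiM run_calls (\<lambda>_. \<Xi>))
      \<rightarrow>\<^sub>M PiM run_calls (\<lambda>_. \<Xi>)"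
    using measurable_space[OF samples_measurable[OF s order_refl]] by (intro measurable_vimage_algebra1) auto
  then show "(\<lambda>w. v (samples s run_calls w))
      \<in> borel_measurable (vimage_algebra (space M) (samples s run_calls) (PiM run_calls (\<lambda>_. \<Xi>)))"
    using v by (rule measurable_compose)
qed simp_all

text \<open>The iterate as a deterministic function of the sample family of its run, so that
  independence of the samples passes to it.\<close>

definition iterate_of_samples :: "nat \<Rightarrow> (nat \<times> nat \<Rightarrow> 'xi) \<Rightarrow> 'a" where
  "iterate_of_samples k p = rspg_iterate prox G (\<lambda>_. \<gamma>) (\<lambda>_. m) x1 (\<lambda>k i. p (k, i)) k"

lemma iterate_of_samples_measurable:
  assumes "k \<le> N"
  shows "iterate_of_samples k \<in> PiM run_calls (\<lambda>_. \<Xi>) \<rightarrow>\<^sub>M borel_X"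
  unfolding iterate_of_samples_def[abs_def] using assms
  by (intro rspg_iterate_measurable measurable_component_singleton) (auto simp: run_calls_def)

lemma iterate_eq: "k \<le> N \<Longrightarrow> iterate s k w = iterate_of_samples k (samples s run_calls w)"
  unfolding iterate_of_samples_def by (rule iterate_eq_samples)

lemma xbar_square_sum:
  assumes "s \<in> {1..S}" "w \<in> space M"
  shows "(norm (gX (xbar s w)))\<^sup>2
    = (\<Sum>k\<in>{1..N}. indicator {k} (R s w) * (norm (gX (iterate s k w)))\<^sup>2)"
proof -
  have "(\<Sum>k\<in>{1..N}. indicator {k} (R s w) * (norm (gX (iterate s k w)))\<^sup>2)
      = (\<Sum>k\<in>{1..N}. if k = R s w then (norm (gX (iterate s k w)))\<^sup>2 else 0)"
    by (intro sum.cong refl) (auto simp: indicator_def)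
  then show ?thesis using R_range[OF assms] by (simp add: xbar_def)
qed

text \<open>The random index is resolved by summing over its values. Each summand is an indicator of
  \<open>R s\<close> times a function of the samples, and independence factors its expectation,
  leaving the plain average over the iterates.\<close>

lemma expected_xbar:
  assumes s: "s \<in> {1..S}"
  shows "integrable M (\<lambda>w. (norm (gX (xbar s w)))\<^sup>2)"
    "(\<integral>w. (norm (gX (xbar s w)))\<^sup>2 \<partial>M) \<le> L * B_Nbar L \<sigma> Dt (D_Psi X f h L x1) Nbar / \<alpha>\<^sup>2"
proof -
  let ?I = "\<lambda>k w. indicator {k} (R s w) :: real"
  let ?g = "\<lambda>k w. (norm (gX (iterate s k w)))\<^sup>2"
  have terms: "integrable M (\<lambda>w. ?I k w * ?g k w)" "(\<integral>w. ?I k w * ?g k w \<partial>M) = (1 / real N) * (\<integral>w. ?g k w \<partial>M)"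
    if k: "k \<in> {1..N}" for k
  proof -
    have [measurable]: "(\<lambda>p. gX (iterate_of_samples k p)) \<in> borel_measurable (PiM run_calls (\<lambda>_. \<Xi>))"
      using k by (intro gX_measurable iterate_of_samples_measurable) auto
    have "(\<lambda>p. (norm (gX (iterate_of_samples k p)))\<^sup>2) \<in> borel_measurable (PiM run_calls (\<lambda>_. \<Xi>))"
      by measurable
    from indep_R_samples[OF s this, of "indicator {k}"]
    have ind: "indep_var borel (?I k) borel (?g k)" using k by (simp add: iterate_eq)
    have Im: "?I k \<in> borel_measurable M"
      by (rule measurable_compose[OF R_measurable[OF s]]) simp
    have Iint: "integrable M (?I k)"
      by (rule integrable_const_bound[where B = 1]) (auto simp: Im)
    have eq: "(\<integral>w. ?I k w \<partial>M) = 1 / real N"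
    proof -
      have "(\<integral>w. ?I k w \<partial>M) = (\<integral>w. indicator {w \<in> space M. R s w = k} w \<partial>M)"
        by (intro Bochner_Integration.integral_cong) (auto simp: indicator_def)
      also have "\<dots> = \<P>(w in M. R s w = k)" by (auto intro!: arg_cong[where f = prob])
      finally show ?thesis using R_probability[OF s k] by simp
    qed
    show "integrable M (\<lambda>w. ?I k w * ?g k w)"
      by (rule indep_var_integrable[OF ind Iint gX_square_integrable[OF s k]])
    show "(\<integral>w. ?I k w * ?g k w \<partial>M) = (1 / real N) * (\<integral>w. ?g k w \<partial>M)"
      using indep_var_lebesgue_integral[OF ind Iint gX_square_integrable[OF s k]] eq by simp
  qed
  have sum: "integrable M (\<lambda>w. \<Sum>k\<in>{1..N}. ?I k w * ?g k w)"
    using terms by (intro Bochner_Integration.integrable_sum) auto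
  then show "integrable M (\<lambda>w. (norm (gX (xbar s w)))\<^sup>2)"
    using xbar_square_sum[OF s] by (subst Bochner_Integration.integrable_cong[OF refl]) auto
  have N: "real N > 0" and m: "real m > 0" using m_N_bounds by auto
  let ?D = "D_Psi X f h L x1"
  have "(\<integral>w. (norm (gX (xbar s w)))\<^sup>2 \<partial>M) = (\<integral>w. (\<Sum>k\<in>{1..N}. ?I k w * ?g k w) \<partial>M)"
    by (intro Bochner_Integration.integral_cong refl xbar_square_sum[OF s])
  also have "\<dots> = (\<Sum>k\<in>{1..N}. (1 / real N) * (\<integral>w. ?g k w \<partial>M))"
    using terms by (subst Bochner_Integration.integral_sum) auto
  also have "\<dots> = (1 / real N) * (\<Sum>k\<in>{1..N}. \<integral>w. ?g k w \<partial>M)" by (rule sum_distrib_left[symmetric])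
  also have "\<dots> \<le> (1 / real N) * (8 * L / \<alpha>\<^sup>2 * (gap + real N * (3 / (4 * L) * (\<sigma>\<^sup>2 / real m))))"
    by (intro mult_left_mono expected_run_bound[OF s]) auto
  also have "\<dots> = (8 * L\<^sup>2 * ?D\<^sup>2 / real N + 6 * \<sigma>\<^sup>2 / real m) / \<alpha>\<^sup>2"
    unfolding gap_eq using N m \<alpha>_pos L_pos by (simp add: field_simps power2_eq_square)
  also have "\<dots> \<le> L * B_Nbar L \<sigma> Dt ?D Nbar / \<alpha>\<^sup>2"
    using B_Nbar_bound[OF L_pos \<sigma>_pos Dt_pos Nbar_pos, of ?D]
    by (intro divide_right_mono) (auto simp: m_def N_def)
  finally show "(\<integral>w. (norm (gX (xbar s w)))\<^sup>2 \<partial>M) \<le> L * B_Nbar L \<sigma> Dt ?D Nbar / \<alpha>\<^sup>2" .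
qed

end

lemma norm_sq_le_twice: "(norm (a::'a::real_normed_vector))\<^sup>2 \<le> 2 * (norm b)\<^sup>2 + 2 * (norm (b - a))\<^sup>2"
proof -
  have "(norm a)\<^sup>2 \<le> (norm b + norm (b - a))\<^sup>2"
    by (intro power_mono) (use norm_triangle_ineq4[of b "b - a"] in auto)
  also have "\<dots> \<le> 2 * (norm b)\<^sup>2 + 2 * (norm (b - a))\<^sup>2"
    using sum_squares_bound[of "norm b" "norm (b - a)"] by (simp add: power2_sum)
  finally show ?thesis .
qed

section \<open>Selection of the candidate by the post-optimization sample\<close>

context two_rspg
begin

text \<open>The index space is all of \<open>nat\<close>, while measurability of the iterates is
  known up to \<open>N\<close> only. Capping with \<open>min\<close> handles the larger indices and
  changes nothing on the range of \<open>R s\<close>.\<close>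

definition xbar_of_run :: "nat \<times> (nat \<times> nat \<Rightarrow> 'xi) \<Rightarrow> 'a" where
  "xbar_of_run z = iterate_of_samples (min (fst z) N) (snd z)"

lemma xbar_of_run_measurable:
  "xbar_of_run \<in> count_space UNIV \<Otimes>\<^sub>M PiM run_calls (\<lambda>_. \<Xi>) \<rightarrow>\<^sub>M borel_X"
  unfolding xbar_of_run_def[abs_def]
  by (rule measurable_compose_countable[where f = "\<lambda>r z. iterate_of_samples (min r N) (snd z)" and g = fst])
    (auto intro: measurable_compose[OF measurable_snd iterate_of_samples_measurable])

lemma xbar_eq:
  "s \<in> {1..S} \<Longrightarrow> w \<in> space M \<Longrightarrow> xbar s w = xbar_of_run (R s w, samples s run_calls w)"
  using R_range[of s w] by (simp add: xbar_def xbar_of_run_def iterate_eq)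

lemma xbar_measurable:
  assumes s: "s \<in> {1..S}"
  shows "xbar s \<in> M \<rightarrow>\<^sub>M borel_X"
  using measurable_compose[OF measurable_Pair[OF R_measurable[OF s] samples_measurable[OF s order_refl]]
      xbar_of_run_measurable]
  by (subst measurable_cong[OF xbar_eq[OF s]])

lemma xbar_in_X: "s \<in> {1..S} \<Longrightarrow> w \<in> space M \<Longrightarrow> xbar s w \<in> X"
  using in_X_if_measurable[OF xbar_measurable] .

lemma post_info_measurable:
  assumes "s \<in> {1..S}" "k \<in> {1..T}"
  shows "(\<lambda>w. (restrict (\<lambda>s'. xbar s' w) {1..S}, restrict (\<lambda>j. \<zeta> s j w) {1..<k}))
    \<in> M \<rightarrow>\<^sub>M PiM {1..S} (\<lambda>_. borel) \<Otimes>\<^sub>M PiM {1..<k} (\<lambda>_. \<Xi>)"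
proof (intro measurable_Pair measurable_restrict)
  show "xbar s' \<in> borel_measurable M" if "s' \<in> {1..S}" for s'
    using xbar_measurable[OF that] measurable_restrict_space2_iff by blast
  show "\<zeta> s j \<in> M \<rightarrow>\<^sub>M \<Xi>" if "j \<in> {1..<k}" for j
    using assms that by (intro \<zeta>_measurable) auto
qed

lemma post_history_subalgebra:
  assumes "s \<in> {1..S}" "k \<in> {1..T}"
  shows "subalgebra M (post_history s k)"
  using post_info_measurable[OF assms]
  unfolding subalgebra_def post_history_def measurable_iff_sets by simp

lemma post_info_history:
  assumes "s \<in> {1..S}" "k \<in> {1..T}"
  shows "(\<lambda>w. (restrict (\<lambda>s'. xbar s' w) {1..S}, restrict (\<lambda>j. \<zeta> s j w) {1..<k}))
    \<in> post_history s k \<rightarrow>\<^sub>M PiM {1..S} (\<lambda>_. borel) \<Otimes>\<^sub>M PiM {1..<k} (\<lambda>_. \<Xi>)"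
  unfolding post_history_def using measurable_space[OF post_info_measurable[OF assms]]
  by (intro measurable_vimage_algebra1) auto

lemma xbar_post_history:
  assumes s: "s \<in> {1..S}" and k: "k \<in> {1..T}"
  shows "xbar s \<in> post_history s k \<rightarrow>\<^sub>M borel_X"
proof (rule measurable_restrict_space2)
  show "xbar s \<in> space (post_history s k) \<rightarrow> X"
    using xbar_in_X[OF s] by (auto simp: post_history_def)
  from measurable_compose[OF measurable_compose[OF post_info_history[OF s k] measurable_fst]
      measurable_component_singleton[OF s]]
  show "xbar s \<in> borel_measurable (post_history s k)" using s by simp
qed

lemma post_sample_history:
  assumes s: "s \<in> {1..S}" and k: "k \<in> {1..T}" and j: "j \<in> {1..<k}"
  shows "\<zeta> s j \<in> post_history s k \<rightarrow>\<^sub>M \<Xi>"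
  using measurable_compose[OF measurable_compose[OF post_info_history[OF s k] measurable_snd]
      measurable_component_singleton[OF j]] j by simp

lemma noise_sequence_post:
  assumes s: "s \<in> {1..S}"
  shows "noise_sequence M (post_history s) (\<lambda>k w. G (xbar s w) (\<zeta> s k w) - gradf (xbar s w)) \<sigma> T"
proof -
  have adapted: "(\<lambda>w. G (xbar s w) (\<zeta> s j w)) \<in> borel_measurable (post_history s k)"
    if "k \<in> {1..T}" "j \<in> {1..<k}" for k j
    by (intro oracle_measurable xbar_post_history post_sample_history s that)
  show ?thesis
    by (rule noise_sequence_oracle[where gradf = gradf and x = "xbar s", OF prob_space_axioms \<sigma>_pos
          post_history_subalgebra[OF s] oracle_measurable[OF xbar_measurable[OF s] \<zeta>_measurable[OF s]]
          gradf_measurable[OF xbar_post_history[OF s]] adapted post_A1[OF s] post_A2[OF s]])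
qed

definition post_noise :: "nat \<Rightarrow> 'w \<Rightarrow> 'a" where
  "post_noise s w = (\<Sum>k\<in>{1..T}. G (xbar s w) (\<zeta> s k w) - gradf (xbar s w))"

definition tail_event :: "real \<Rightarrow> nat \<Rightarrow> 'w set" where
  "tail_event l s = {w\<in>space M. 2 * (1 + l)\<^sup>2 * real T * \<sigma>\<^sup>2 \<le> (norm (post_noise s w))\<^sup>2}"

definition bad_event :: "'w set" where
  "bad_event = {w\<in>space M. \<forall>s\<in>{1..S}.
     2 * (L * B_Nbar L \<sigma> Dt (D_Psi X f h L x1) Nbar / \<alpha>\<^sup>2) \<le> (norm (gX (xbar s w)))\<^sup>2}"

lemma tail_event_measurable:
  assumes s: "s \<in> {1..S}"
  shows "tail_event l s \<in> sets M"
proof -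
  interpret ns: noise_sequence M "post_history s" "\<lambda>k w. G (xbar s w) (\<zeta> s k w) - gradf (xbar s w)" \<sigma> T
    by (rule noise_sequence_post[OF s])
  have [measurable]: "post_noise s \<in> borel_measurable M"
    unfolding post_noise_def[abs_def] by (rule ns.partial_measurable[OF order_refl])
  show ?thesis unfolding tail_event_def by measurable
qed

lemma prob_tail_event:
  assumes s: "s \<in> {1..S}" and l: "l > 0"
  shows "prob (tail_event l s) \<le> exp (- (l\<^sup>2) / 3)"
proof -
  interpret ns: noise_sequence M "post_history s" "\<lambda>k w. G (xbar s w) (\<zeta> s k w) - gradf (xbar s w)" \<sigma> T
    by (rule noise_sequence_post[OF s])
  show ?thesis unfolding tail_event_def post_noise_def using T_pos l by (rule ns.noise_tail)
qed

lemma prob_bad_event: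
  shows "bad_event \<in> sets M" "prob bad_event \<le> 1 / 2 ^ S"
proof -
  define c where "c = L * B_Nbar L \<sigma> Dt (D_Psi X f h L x1) Nbar / \<alpha>\<^sup>2"
  have c: "c > 0" unfolding c_def
    using L_pos \<alpha>_pos B_Nbar_pos[OF L_pos \<sigma>_pos Dt_pos Nbar_pos] by simp
  define V where "V z = (norm (gX (xbar_of_run z)))\<^sup>2" for z
  \<comment> \<open>A function of the run data for every \<open>w\<close>, so that
    \<open>runs_indep\<close> applies directly. It agrees with the squared norm at
    \<open>xbar s w\<close> on \<open>space M\<close>, where the range of the index is
    known.\<close>
  define W where "W s w = V (R s w, samples s run_calls w)" for s w
  have W: "W s w = (norm (gX (xbar s w)))\<^sup>2" if "s \<in> {1..S}" "w \<in> space M" for s w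
    using that by (simp add: W_def V_def xbar_eq)
  have V: "V \<in> borel_measurable (count_space UNIV \<Otimes>\<^sub>M PiM run_calls (\<lambda>_. \<Xi>))"
  proof -
    note [measurable] = gX_measurable[OF xbar_of_run_measurable]
    show ?thesis unfolding V_def by measurable
  qed
  have indep: "indep_vars (\<lambda>_. borel) W {1..S}"
    unfolding W_def[abs_def] using runs_indep V by (rule indep_vars_compose2)
  have "bad_event = {w\<in>space M. \<forall>s\<in>{1..S}. 2 * c \<le> W s w}"
    unfolding bad_event_def c_def[symmetric] by (intro Collect_cong conj_cong ball_cong refl) (simp only: W)
  also have "\<dots> = (\<Inter>s\<in>{1..S}. W s -` {2 * c..} \<inter> space M)"
  \<comment> \<open>A nonempty index set is essential: only then does the intersection stay inside
    \<open>space M\<close>.\<close>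
  proof -
    have "1 \<in> {1..S}" using S_pos by simp
    then show ?thesis by blast
  qed
  finally have bad: "bad_event = (\<Inter>s\<in>{1..S}. W s -` {2 * c..} \<inter> space M)" .
  have Wm: "W s \<in> borel_measurable M" if "s \<in> {1..S}" for s
    using indep that unfolding indep_vars_def by auto
  show "bad_event \<in> sets M"
    unfolding bad using measurable_sets[OF Wm, of _ "{2 * c..}"] S_pos by (intro sets.finite_INT) auto
  have half: "prob (W s -` {2 * c..} \<inter> space M) \<le> 1 / 2" if s: "s \<in> {1..S}" for s
  proof -
    note int = expected_xbar[OF s, folded c_def]
    have "prob (W s -` {2 * c..} \<inter> space M) = prob {w\<in>space M. 2 * c \<le> (norm (gX (xbar s w)))\<^sup>2}"
      using W[OF s] by (intro arg_cong[where f = prob]) auto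
    also have "\<dots> \<le> (\<integral>w. (norm (gX (xbar s w)))\<^sup>2 \<partial>M) / (2 * c)"
      by (rule integral_Markov_inequality_measure[OF int(1), where A = "{}"]) (use c in simp_all)
    also have "\<dots> \<le> c / (2 * c)" by (rule divide_right_mono[OF int(2)]) (use c in simp)
    also have "\<dots> = 1 / 2" using c by simp
    finally show ?thesis .
  qed
  have "prob bad_event = (\<Prod>s\<in>{1..S}. prob (W s -` {2 * c..} \<inter> space M))"
    unfolding bad using S_pos by (intro indep_varsD_finite[OF indep, where A = "\<lambda>_. {2 * c..}"]) simp_all
  also have "\<dots> \<le> (\<Prod>s\<in>{1..S}. 1 / 2)"
    by (intro prod_mono conjI measure_nonneg half)
  also have "\<dots> = 1 / 2 ^ S" by (simp add: power_divide)
  finally show "prob bad_event \<le> 1 / 2 ^ S" .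
qed

lemma gbar_error:
  assumes "s \<in> {1..S}" "w \<in> space M"
  shows "(norm (gbar s w - gX (xbar s w)))\<^sup>2 \<le> (norm (post_noise s w))\<^sup>2 / (real T * \<alpha>)\<^sup>2"
proof -
  have "oracle_mean G (xbar s w) T (\<lambda>k. \<zeta> s k w) - gradf (xbar s w) = (1 / real T) *\<^sub>R post_noise s w"
    using T_pos by (simp add: oracle_mean_def post_noise_def sum_subtractf scaleR_diff_right
        sum_constant_scaleR del: sum_constant)
  then have "norm (gbar s w - gX (xbar s w)) \<le> norm (post_noise s w) / (real T * \<alpha>)"
    using pgrad_lipschitz[OF xbar_in_X[OF assms] stepsize_pos,
        of "oracle_mean G (xbar s w) T (\<lambda>k. \<zeta> s k w)" "gradf (xbar s w)"]
    by (simp add: gbar_def \<gamma>_def)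
  then have "(norm (gbar s w - gX (xbar s w)))\<^sup>2 \<le> (norm (post_noise s w) / (real T * \<alpha>))\<^sup>2"
    by (rule power_mono) simp
  then show ?thesis by (simp add: power_divide)
qed

text \<open>One good candidate \<open>s0\<close> suffices, as the selected one has no larger
  estimated norm. The excluded events are defined by nonstrict inequalities, so the conclusion is
  strict. This matches the event in the deviation bound, which includes equality.\<close>

lemma good_outcome:
  assumes w: "w \<in> space M" "w \<notin> bad_event" "w \<notin> (\<Union>s\<in>{1..S}. tail_event l s)"
  shows "(norm (gX (xstar w)))\<^sup>2
    < 8 * L * B_Nbar L \<sigma> Dt (D_Psi X f h L x1) Nbar / \<alpha>\<^sup>2 + 12 * (1 + l)\<^sup>2 * \<sigma>\<^sup>2 / (real T * \<alpha>\<^sup>2)"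
proof -
  define c where "c = L * B_Nbar L \<sigma> Dt (D_Psi X f h L x1) Nbar / \<alpha>\<^sup>2"
  define e where "e = 2 * (1 + l)\<^sup>2 * \<sigma>\<^sup>2 / (real T * \<alpha>\<^sup>2)"
  have T: "real T > 0" using T_pos by simp
  have err: "(norm (gbar s w - gX (xbar s w)))\<^sup>2 < e" if s: "s \<in> {1..S}" for s
  proof -
    have "(norm (post_noise s w))\<^sup>2 < 2 * (1 + l)\<^sup>2 * real T * \<sigma>\<^sup>2"
      using w s by (auto simp: tail_event_def not_le)
    then have "(norm (post_noise s w))\<^sup>2 / (real T * \<alpha>)\<^sup>2 < 2 * (1 + l)\<^sup>2 * real T * \<sigma>\<^sup>2 / (real T * \<alpha>)\<^sup>2"
      using T \<alpha>_pos by (intro divide_strict_right_mono) auto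
    also have "\<dots> = e" using T by (simp add: e_def power_mult_distrib power2_eq_square mult_ac)
    finally show ?thesis using gbar_error[OF s w(1)] by simp
  qed
  obtain s0 where s0: "s0 \<in> {1..S}" "(norm (gX (xbar s0 w)))\<^sup>2 < 2 * c"
    using w by (auto simp: bad_event_def c_def not_le)
  obtain s where s: "s \<in> {1..S}" "xstar w = xbar s w"
    "norm (gbar s w) = (MIN s'\<in>{1..S}. norm (gbar s' w))"
    using xstar_output[OF w(1)] by blast
  have "norm (gbar s w) \<le> norm (gbar s0 w)" unfolding s(3) using s0(1) by (intro Min_le) auto
  then have "(norm (gbar s w))\<^sup>2 \<le> (norm (gbar s0 w))\<^sup>2" by (rule power_mono) simp
  also have "\<dots> \<le> 2 * (norm (gX (xbar s0 w)))\<^sup>2 + 2 * (norm (gbar s0 w - gX (xbar s0 w)))\<^sup>2"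
    using norm_sq_le_twice[of "gbar s0 w" "gX (xbar s0 w)"] by (simp add: norm_minus_commute)
  finally have "(norm (gX (xbar s w)))\<^sup>2 < 4 * (2 * c) + 6 * e"
    using norm_sq_le_twice[of "gX (xbar s w)" "gbar s w"] err[OF s(1)] err[OF s0(1)] s0(2) by linarith
  then show ?thesis by (simp add: s(2) c_def e_def)
qed

lemma gX_xstar_measurable: "(\<lambda>w. gX (xstar w)) \<in> borel_measurable M"
proof (intro gX_measurable measurable_restrict_space2 xstar_measurable)
  show "xstar \<in> space M \<rightarrow> X"
    using xstar_output xbar_in_X by fastforce
qed

theorem deviation_bound:
  assumes l: "l > 0"
  shows "prob {w\<in>space M. (norm (gX (xstar w)))\<^sup>2 \<ge> 8 * L * B_Nbar L \<sigma> Dt (D_Psi X f h L x1) Nbar / \<alpha>\<^sup>2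
        + 12 * (1 + l)\<^sup>2 * \<sigma>\<^sup>2 / (real T * \<alpha>\<^sup>2)}
    \<le> real S * exp (- (l\<^sup>2) / 3) + 1 / 2 ^ S" (is "prob ?E \<le> _")
proof -
  have tail: "(\<Union>s\<in>{1..S}. tail_event l s) \<in> sets M"
    using tail_event_measurable by (intro sets.finite_UN) auto
  have "prob ?E \<le> prob ((\<Union>s\<in>{1..S}. tail_event l s) \<union> bad_event)"
    using good_outcome[of _ l] tail prob_bad_event(1)
    by (intro finite_measure_mono) (auto simp: not_less[symmetric])
  also have "\<dots> \<le> prob (\<Union>s\<in>{1..S}. tail_event l s) + prob bad_event"
    by (rule measure_Un_le[OF tail prob_bad_event(1)])
  also have "prob (\<Union>s\<in>{1..S}. tail_event l s) \<le> (\<Sum>s\<in>{1..S}. prob (tail_event l s))"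
    using tail_event_measurable by (intro measure_UNION_le) auto
  also have "\<dots> \<le> (\<Sum>s\<in>{1..S}. exp (- (l\<^sup>2) / 3))"
    using prob_tail_event l by (intro sum_mono) auto
  finally show ?thesis using prob_bad_event(2) by simp
qed

text \<open>An index \<open>R s w\<close> costs one batch fewer than its value, hence at most
  \<open>N * m\<close> calls, and the iteration limit was rounded so that this stays within
  \<open>Nbar\<close>.\<close>

lemma calls_bound:
  assumes "w \<in> space M"
  shows "two_rspg_calls L \<sigma> Dt S Nbar T (\<lambda>s. R s w) \<le> S * (Nbar + T)"
proof -
  have "rspg_calls (\<lambda>_. m) (R s w) \<le> Nbar" if "s \<in> {1..S}" for s
  proof -
    have "rspg_calls (\<lambda>_. m) (R s w) \<le> N * m"
      using R_range[OF that assms] by (auto simp: rspg_calls_def intro: mult_right_mono)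
    then show ?thesis using m_N_bounds(3) by simp
  qed
  then have "(\<Sum>s\<in>{1..S}. rspg_calls (\<lambda>_. m) (R s w)) \<le> (\<Sum>s\<in>{1..S}. Nbar)" by (rule sum_mono)
  then show ?thesis by (simp add: two_rspg_calls_def m_def[symmetric] distrib_left)
qed

end

section \<open>Choice of the parameters\<close>

text \<open>The three lower bounds on \<open>Nbar\<close> have separate roles. The first bounds the
  term of order \<open>1 / Nbar\<close> by \<open>\<epsilon> / 4\<close>, the second does the same
  for the term of order \<open>1 / sqrt Nbar\<close>, and the third makes the inner
  \<open>max\<close> equal to 1.\<close>

lemma B_Nbar_of_le:
  fixes \<alpha> L \<sigma> Dt D \<epsilon> :: real
  assumes pos: "\<alpha> > 0" "L > 0" "\<sigma> > 0" "Dt > 0" "\<epsilon> > 0"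
    and Nbar: "Nbar = Nbar_of \<alpha> L \<sigma> Dt D \<epsilon>" "Nbar \<ge> 1"
  shows "8 * L * B_Nbar L \<sigma> Dt D Nbar / \<alpha>\<^sup>2 \<le> \<epsilon> / 2"
proof -
  define n where "n = real Nbar"
  define r where "r = sqrt n"
  define q where "q = sqrt (6::real)"
  define E where "E = D\<^sup>2 / Dt + Dt"
  let ?Q = "{512 * L\<^sup>2 * D\<^sup>2 / (\<alpha>\<^sup>2 * \<epsilon>),
      ((Dt + D\<^sup>2 / Dt) * (128 * sqrt 6 * L * \<sigma> / (\<alpha>\<^sup>2 * \<epsilon>)))\<^sup>2, 3 * \<sigma>\<^sup>2 / (8 * L\<^sup>2 * Dt\<^sup>2)}"
  have n0: "n > 0" using Nbar(2) by (simp add: n_def)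
  have r: "r > 0" "r * r = n" using n0 by (auto simp: r_def)
  have q: "q > 0" "q * q = 6" by (auto simp: q_def)
  have "Max ?Q \<le> n" unfolding n_def Nbar(1) Nbar_of_def by (rule real_nat_ceiling_ge)
  then have n: "512 * L\<^sup>2 * D\<^sup>2 / (\<alpha>\<^sup>2 * \<epsilon>) \<le> n" "(E * (128 * q * L * \<sigma> / (\<alpha>\<^sup>2 * \<epsilon>)))\<^sup>2 \<le> n"
    "3 * \<sigma>\<^sup>2 / (8 * L\<^sup>2 * Dt\<^sup>2) \<le> n"
    by (auto simp: E_def q_def add.commute)
  have 1: "128 * L\<^sup>2 * D\<^sup>2 / (n * \<alpha>\<^sup>2) \<le> \<epsilon> / 4"
    using n(1) n0 pos by (simp add: field_simps)
  have "E * (128 * q * L * \<sigma> / (\<alpha>\<^sup>2 * \<epsilon>)) \<le> r"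
    unfolding r_def using n(2) by (rule real_le_rsqrt)
  then have 2: "32 * q * L * \<sigma> * E / (r * \<alpha>\<^sup>2) \<le> \<epsilon> / 4"
    using r(1) pos by (simp add: field_simps)
  have "(q * \<sigma>)\<^sup>2 = 6 * \<sigma>\<^sup>2" unfolding q(2)[symmetric] by (simp add: power2_eq_square)
  also have "\<dots> \<le> 16 * L\<^sup>2 * Dt\<^sup>2 * n" using n(3) pos by (simp add: field_simps)
  also have "\<dots> = (4 * L * Dt * r)\<^sup>2" unfolding r(2)[symmetric] by (simp add: power2_eq_square)
  finally have "(q * \<sigma>)\<^sup>2 \<le> (4 * L * Dt * r)\<^sup>2" .
  then have "q * \<sigma> \<le> 4 * L * Dt * r"
    by (rule power2_le_imp_le) (use pos r in simp)
  then have mx: "max 1 (q * \<sigma> / (4 * L * Dt * r)) = 1" using pos r(1) by (simp add: max_def)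
  have "B_Nbar L \<sigma> Dt D Nbar = 16 * L * D\<^sup>2 / n + 4 * q * \<sigma> / r * E"
    unfolding B_Nbar_def n_def[symmetric] r_def[symmetric] q_def[symmetric] mx E_def by simp
  then have "8 * L * B_Nbar L \<sigma> Dt D Nbar / \<alpha>\<^sup>2
      = 128 * L\<^sup>2 * D\<^sup>2 / (n * \<alpha>\<^sup>2) + 32 * q * L * \<sigma> * E / (r * \<alpha>\<^sup>2)"
    using n0 r(1) pos by (simp add: distrib_left add_divide_distrib power2_eq_square mult_ac)
  then show ?thesis using 1 2 by simp
qed

lemma T_of_le:
  fixes \<alpha> \<sigma> \<epsilon> \<Lambda> :: real
  assumes pos: "\<alpha> > 0" "\<epsilon> > 0" and T: "T = T_of \<alpha> \<sigma> \<epsilon> \<Lambda>" "T \<ge> 1"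
  shows "12 * (1 + sqrt (3 * log 2 (2 * real (S_of \<Lambda>) / \<Lambda>)))\<^sup>2 * \<sigma>\<^sup>2 / (real T * \<alpha>\<^sup>2) \<le> \<epsilon> / 2"
proof -
  define l where "l = (1 + sqrt (3 * log 2 (2 * real (S_of \<Lambda>) / \<Lambda>)))\<^sup>2"
  have "24 * \<sigma>\<^sup>2 / (\<alpha>\<^sup>2 * \<epsilon>) * l \<le> real T"
    unfolding T(1) T_of_def l_def by (rule real_nat_ceiling_ge)
  then have "24 * \<sigma>\<^sup>2 * l \<le> real T * (\<alpha>\<^sup>2 * \<epsilon>)" using pos by (simp add: field_simps)
  then show ?thesis unfolding l_def[symmetric] using pos T(2) by (simp add: field_simps)
qed

text \<open>The budget \<Lambda> is split in halves. The choice of \<open>S\<close> makes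
  \<open>1 / 2 ^ S\<close> at most \<open>\<Lambda> / 2\<close>. In the other half
  \<open>l\<^sup>2 / 3\<close> is a logarithm to base 2, which dominates the natural one for
  arguments above 1, so each of the \<open>S\<close> tails is at most
  \<open>\<Lambda> / (2 * S)\<close>.\<close>

lemma failure_probability_le:
  fixes \<Lambda> :: real
  assumes \<Lambda>: "0 < \<Lambda>" "\<Lambda> < 1"
  defines "S \<equiv> S_of \<Lambda>"
  defines "l \<equiv> sqrt (3 * log 2 (2 * real S / \<Lambda>))"
  shows "l > 0" "real S * exp (- (l\<^sup>2) / 3) + 1 / 2 ^ S \<le> \<Lambda>"
proof -
  define y where "y = 2 * real S / \<Lambda>"
  have "log 2 (2 / \<Lambda>) > 0" using \<Lambda> by simp
  moreover have S: "log 2 (2 / \<Lambda>) \<le> real S" unfolding S_def S_of_def by (rule real_nat_ceiling_ge)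
  ultimately have S1: "real S \<ge> 1" by simp
  then have y: "y > 1" using \<Lambda> by (simp add: y_def field_simps)
  then have log: "log 2 y > 0" by simp
  then show "l > 0" by (simp add: l_def y_def)
  have ln2: "0 < ln (2::real)" "ln (2::real) \<le> 1" using ln_le_minus_one[of 2] by auto
  have "ln y * ln 2 \<le> ln y * 1" using y ln2 by (intro mult_left_mono) auto
  then have "ln y \<le> log 2 y" using ln2 by (simp add: log_def field_simps)
  then have "exp (- log 2 y) \<le> exp (- ln y)" by simp
  also have "\<dots> = 1 / y" using y by (simp add: exp_minus inverse_eq_divide)
  finally have e: "exp (- log 2 y) \<le> 1 / y" .
  have l2: "- (l\<^sup>2) / 3 = - log 2 y" using log by (simp add: l_def y_def)
  have "real S * exp (- (l\<^sup>2) / 3) \<le> real S * (1 / y)" unfolding l2 by (rule mult_left_mono[OF e]) simp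
  also have "\<dots> = \<Lambda> / 2" using S1 \<Lambda> by (simp add: y_def)
  finally have 1: "real S * exp (- (l\<^sup>2) / 3) \<le> \<Lambda> / 2" .
  have "2 / \<Lambda> = 2 powr log 2 (2 / \<Lambda>)" using \<Lambda> by simp
  also have "\<dots> \<le> 2 powr real S" using S by (intro powr_mono) auto
  also have "\<dots> = 2 ^ S" by (simp add: powr_realpow)
  finally have "1 / 2 ^ S \<le> \<Lambda> / 2" using \<Lambda> by (simp add: field_simps)
  with 1 show "real S * exp (- (l\<^sup>2) / 3) + 1 / 2 ^ S \<le> \<Lambda>" by simp
qed

lemma (in two_rspg) solution_probability:
  fixes \<epsilon> \<Lambda> :: real
  assumes \<epsilon>: "\<epsilon> > 0" and \<Lambda>: "0 < \<Lambda>" "\<Lambda> < 1"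
    and S: "S = S_of \<Lambda>" and Nbar: "Nbar = Nbar_of \<alpha> L \<sigma> Dt (D_Psi X f h L x1) \<epsilon>"
    and T: "T = T_of \<alpha> \<sigma> \<epsilon> \<Lambda>"
  shows "prob {w\<in>space M. (norm (gX (xstar w)))\<^sup>2 \<le> \<epsilon>} \<ge> 1 - \<Lambda>"
proof -
  define l where "l = sqrt (3 * log 2 (2 * real (S_of \<Lambda>) / \<Lambda>))"
  let ?b = "8 * L * B_Nbar L \<sigma> Dt (D_Psi X f h L x1) Nbar / \<alpha>\<^sup>2 + 12 * (1 + l)\<^sup>2 * \<sigma>\<^sup>2 / (real T * \<alpha>\<^sup>2)"
  note [measurable] = gX_xstar_measurable
  have l: "l > 0" "real S * exp (- (l\<^sup>2) / 3) + 1 / 2 ^ S \<le> \<Lambda>"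
    using failure_probability_le[OF \<Lambda>] unfolding S l_def by auto
  have b: "?b \<le> \<epsilon>"
    using B_Nbar_of_le[OF \<alpha>_pos L_pos \<sigma>_pos Dt_pos \<epsilon> Nbar Nbar_pos] T_of_le[OF \<alpha>_pos \<epsilon> T T_pos]
    unfolding l_def by linarith
  have "1 - prob {w\<in>space M. (norm (gX (xstar w)))\<^sup>2 \<le> \<epsilon>}
      = prob {w\<in>space M. \<not> (norm (gX (xstar w)))\<^sup>2 \<le> \<epsilon>}"
    by (subst prob_neg) auto
  also have "\<dots> \<le> prob {w\<in>space M. (norm (gX (xstar w)))\<^sup>2 \<ge> ?b}"
    using b by (intro finite_measure_mono) auto
  also have "\<dots> \<le> \<Lambda>" using deviation_bound[OF l(1)] l(2) by linarith
  finally show ?thesis by simp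
qed

theorem corollary5:
  fixes X :: "'a::euclidean_space set"
    and f :: "'a \<Rightarrow> real" and gradf :: "'a \<Rightarrow> 'a" and h :: "'a \<Rightarrow> real" and L :: real
    and \<omega> :: "'a \<Rightarrow> real" and grad\<omega> :: "'a \<Rightarrow> 'a" and \<alpha> :: real
    and M :: "'w measure" and \<Xi> :: "'xi measure" and G :: "'a \<Rightarrow> 'xi \<Rightarrow> 'a"
    and \<sigma> Dt :: real and x1 :: 'a and S Nbar T :: nat
    and R :: "nat \<Rightarrow> 'w \<Rightarrow> nat" and \<xi> :: "nat \<Rightarrow> nat \<Rightarrow> nat \<Rightarrow> 'w \<Rightarrow> 'xi"
    and \<zeta> :: "nat \<Rightarrow> nat \<Rightarrow> 'w \<Rightarrow> 'xi" and xstar :: "'w \<Rightarrow> 'a"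
    and D :: real and gX :: "'a \<Rightarrow> 'a"
  assumes "two_rspg X f gradf h L \<omega> grad\<omega> \<alpha> M \<Xi> G \<sigma> Dt x1 S Nbar T R \<xi> \<zeta> xstar"
    and "D = D_Psi X f h L x1"
    and "\<And>x. gX x = gen_proj_grad X h \<omega> grad\<omega> x (gradf x) (\<alpha> / (2 * L))"
  shows "(\<forall>l>0. \<P>(w in M. (norm (gX (xstar w)))\<^sup>2
                    \<ge> 8 * L * B_Nbar L \<sigma> Dt D Nbar / \<alpha>\<^sup>2 + 12 * (1 + l)\<^sup>2 * \<sigma>\<^sup>2 / (real T * \<alpha>\<^sup>2))
                \<le> real S * exp (- (l\<^sup>2) / 3) + 1 / 2 ^ S)
       \<and> (\<forall>\<epsilon> \<Lambda>. \<epsilon> > 0 \<longrightarrow> 0 < \<Lambda> \<longrightarrow> \<Lambda> < 1 \<longrightarrow>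
            S = S_of \<Lambda> \<longrightarrow> Nbar = Nbar_of \<alpha> L \<sigma> Dt D \<epsilon> \<longrightarrow> T = T_of \<alpha> \<sigma> \<epsilon> \<Lambda> \<longrightarrow>
            \<P>(w in M. (norm (gX (xstar w)))\<^sup>2 \<le> \<epsilon>) \<ge> 1 - \<Lambda>
            \<and> (\<forall>w\<in>space M. two_rspg_calls L \<sigma> Dt S Nbar T (\<lambda>s. R s w)
                             \<le> S_of \<Lambda> * (Nbar_of \<alpha> L \<sigma> Dt D \<epsilon> + T_of \<alpha> \<sigma> \<epsilon> \<Lambda>)))"
proof -
  interpret A: two_rspg X f gradf h L \<omega> grad\<omega> \<alpha> M \<Xi> G \<sigma> Dt x1 S Nbar T R \<xi> \<zeta> xstar
    by (rule assms(1))
  note bound = A.deviation_bound[unfolded A.\<gamma>_def, folded assms(2,3)]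
    and sol = A.solution_probability[unfolded A.\<gamma>_def, folded assms(2,3)]
  show ?thesis
  proof (intro conjI allI impI ballI, goal_cases)
    case (1 l)
    then show ?case by (rule bound)
  next
    case (2 \<epsilon> \<Lambda>)
    then show ?case by (rule sol)
  next
    case (3 \<epsilon> \<Lambda> w)
    then show ?case using A.calls_bound[of w] by simp
  qed
qed

end
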